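(* There exists a measurable set $\Theta'\subset\Theta$ with $G(\Theta')=1$ such that for every pacing function $\mu:\Theta\to\mathbb{R}_{\ge0}$ and every buyer type $(w,B)\in\Theta'$ the following holds: if $t^*\in\arg\min_{t\ge0}q^\mu(w,B,t)$, then the bidding function $\alpha\mapsto\sigma^\mu_\alpha\big(w^T\alpha/(1+t^* )\big)$ is an optimal solution of the optimization problem $Q^\mu(w,B)$.
   Context: Setting. Fix integers $n\ge 2$ and $d\ge 2$, and constants $U>0$, $B_{\min}>0$. Buyer types are $\theta=(w,B)\in\Theta:=(0,U)^d\times(B_{\min},U)$; $\Theta_w:=(0,U)^d$. Item types are $\alpha\in A\subset\mathbb{R}^d_{+}$ (strictly positive orthant); all sets carry the Lebesgue $\sigma$-algebra. $F$ is a probability distribution on $A$ with a density and $G$ a probability distribution on $\Theta$ with a density. Buyer $(w,B)$ values item $\alpha$ at $w^T\alpha$; $\omega>0$ is a constant with $w^T\alpha\le\omega$ for all $w\in\Theta_w,\alpha\in A$. Reserve prices: measurable $r:A\to(0,\infty)$. A pacing function is a measurable $\mu:\Theta\to\mathbb{R}_{\ge0}$. For $\alpha\in A$, $\lambda^\mu_\alpha$ is the distribution of $w^T\alpha/(1+\mu(w,B))$ when $(w,B)\sim G$, and $H^\mu_\alpha$ the distribution of the maximum of $n-1$ i.i.d. draws from $\lambda^\mu_\alpha$; $H^\mu_\alpha(x):=\lambda^\mu_\alpha((-\infty,x])^{n-1}$. Define $\sigma^\mu_\alpha(x)=x$ if $x<r(\alpha)$; for $x\ge r(\alpha)$, $\sigma^\mu_\alpha(x)=x-\int_{r(\alpha)}^x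 \frac{H^\mu_\alpha(s)}{H^\mu_\alpha(x)}ds$ if $H^\mu_\alpha(x)>0$ and $\sigma^\mu_\alpha(x)=r(\alpha)$ if $H^\mu_\alpha(x)=0$. The value-pacing-based strategy is $\beta^\mu(w,B,\alpha):=\sigma^\mu_\alpha\big(w^T\alpha/(1+\mu(w,B))\big)$. $Q^\mu(w,B)$ is the problem $\max_{b:A\to\mathbb{R}_{\ge0}}\mathbb{E}_{\alpha,\{\theta_i\}_{i=1}^{n-1}}\big[(w^T\alpha-b(\alpha))\mathbf 1\{b(\alpha)\ge\max(r(\alpha),\{\beta^\mu(\theta_i,\alpha)\}_i)\}\big]$ subject to $\mathbb{E}_{\alpha,\{\theta_i\}}\big[b(\alpha)\mathbf 1\{b(\alpha)\ge\max(r(\alpha),\{\beta^\mu(\theta_i,\alpha)\}_i)\}\big]\le B$, over measurable $b$, with $\alpha\sim F$ and $\theta_1,\dots,\theta_{n-1}\sim G$ i.i.d. independent of $\alpha$. The (Lagrangian) dual function is $q^\mu(w,B,t):=(1+t)\,\mathbb{E}_{\alpha\sim F}\Big[\mathbf 1\Big\{\frac{w^T\alpha}{1+t}\ge r(\alpha)\Big\}\int_{r(\alpha)}^{\frac{w^T\alpha}{1+t}}H^\mu_\alpha(s)\,ds\Big]+tB$, for $t\ge0$. *)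

theory Defs
  imports "HOL-Probability.Probability"
begin

definition Theta_w :: "real \<Rightarrow> (real^'d) set" where
  "Theta_w U = {w. \<forall>i. 0 < w $ i \<and> w $ i < U}"

definition Theta :: "real \<Rightarrow> real \<Rightarrow> ((real^'d) \<times> real) set" where
  "Theta U Bmin = Theta_w U \<times> {Bmin<..<U}"

definition pacing_function :: "real \<Rightarrow> real \<Rightarrow> ((real^'d) \<times> real \<Rightarrow> real) \<Rightarrow> bool" where
  "pacing_function U Bmin mu \<longleftrightarrow>
     mu \<in> borel_measurable lebesgue \<and> (\<forall>\<theta>\<in>Theta U Bmin. 0 \<le> mu \<theta>)"

definition lambda_dist :: "((real^'d) \<times> real) measure \<Rightarrow> ((real^'d) \<times> real \<Rightarrow> real) \<Rightarrow> real^'d \<Rightarrow> real measure" where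
  "lambda_dist G mu \<alpha> = distr G borel (\<lambda>\<theta>. (fst \<theta> \<bullet> \<alpha>) / (1 + mu \<theta>))"

definition H_fun :: "nat \<Rightarrow> ((real^'d) \<times> real) measure \<Rightarrow> ((real^'d) \<times> real \<Rightarrow> real) \<Rightarrow> real^'d \<Rightarrow> real \<Rightarrow> real" where
  "H_fun n G mu \<alpha> x = (measure (lambda_dist G mu \<alpha>) {..x}) ^ (n - 1)"

definition sigma_fun :: "nat \<Rightarrow> ((real^'d) \<times> real) measure \<Rightarrow> ((real^'d) \<times> real \<Rightarrow> real)
    \<Rightarrow> (real^'d \<Rightarrow> real) \<Rightarrow> real^'d \<Rightarrow> real \<Rightarrow> real" where
  "sigma_fun n G mu r \<alpha> x =
     (if x < r \<alpha> then x
      else if H_fun n G mu \<alpha> x > 0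
        then x - (LBINT s:{r \<alpha>..x}. H_fun n G mu \<alpha> s / H_fun n G mu \<alpha> x)
      else r \<alpha>)"

definition beta_fun :: "nat \<Rightarrow> ((real^'d) \<times> real) measure \<Rightarrow> ((real^'d) \<times> real \<Rightarrow> real)
    \<Rightarrow> (real^'d \<Rightarrow> real) \<Rightarrow> (real^'d) \<times> real \<Rightarrow> real^'d \<Rightarrow> real" where
  "beta_fun n G mu r \<theta> \<alpha> = sigma_fun n G mu r \<alpha> ((fst \<theta> \<bullet> \<alpha>) / (1 + mu \<theta>))"

text \<open>Joint law of (alpha, theta_1, ..., theta_{n-1}); the competitors are indexed by {..<n-1}.\<close>

definition auction_space :: "nat \<Rightarrow> (real^'d) measure \<Rightarrow> ((real^'d) \<times> real) measure
    \<Rightarrow> ((real^'d) \<times> (nat \<Rightarrow> (real^'d) \<times> real)) measure" where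
  "auction_space n F G = F \<Otimes>\<^sub>M PiM {..<n - 1} (\<lambda>_. G)"

definition wins :: "nat \<Rightarrow> ((real^'d) \<times> real) measure \<Rightarrow> ((real^'d) \<times> real \<Rightarrow> real)
    \<Rightarrow> (real^'d \<Rightarrow> real) \<Rightarrow> (real^'d \<Rightarrow> real) \<Rightarrow> real^'d \<Rightarrow> (nat \<Rightarrow> (real^'d) \<times> real) \<Rightarrow> bool" where
  "wins n G mu r b \<alpha> \<theta>s \<longleftrightarrow>
     b \<alpha> \<ge> Max (insert (r \<alpha>) ((\<lambda>i. beta_fun n G mu r (\<theta>s i) \<alpha>) ` {..<n - 1}))"

definition Q_objective :: "nat \<Rightarrow> (real^'d) measure \<Rightarrow> ((real^'d) \<times> real) measure \<Rightarrow> ((real^'d) \<times> real \<Rightarrow> real)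
    \<Rightarrow> (real^'d \<Rightarrow> real) \<Rightarrow> real^'d \<Rightarrow> (real^'d \<Rightarrow> real) \<Rightarrow> real" where
  "Q_objective n F G mu r w b =
     (\<integral>z. (w \<bullet> fst z - b (fst z)) * (if wins n G mu r b (fst z) (snd z) then 1 else 0)
        \<partial>auction_space n F G)"

text \<open>Expected payment (nonnegative integrand, taken as a nonnegative integral so that
  feasibility entails finiteness of the expected payment).\<close>

definition Q_payment :: "nat \<Rightarrow> (real^'d) measure \<Rightarrow> ((real^'d) \<times> real) measure \<Rightarrow> ((real^'d) \<times> real \<Rightarrow> real)
    \<Rightarrow> (real^'d \<Rightarrow> real) \<Rightarrow> (real^'d \<Rightarrow> real) \<Rightarrow> ennreal" where
  "Q_payment n F G mu r b =
     (\<integral>\<^sup>+z. ennreal (b (fst z) * (if wins n G mu r b (fst z) (snd z) then 1 else 0))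
        \<partial>auction_space n F G)"

definition Q_feasible :: "nat \<Rightarrow> (real^'d) set \<Rightarrow> (real^'d) measure \<Rightarrow> ((real^'d) \<times> real) measure
    \<Rightarrow> ((real^'d) \<times> real \<Rightarrow> real) \<Rightarrow> (real^'d \<Rightarrow> real) \<Rightarrow> real \<Rightarrow> (real^'d \<Rightarrow> real) \<Rightarrow> bool" where
  "Q_feasible n A F G mu r B b \<longleftrightarrow>
     b \<in> borel_measurable F \<and> (\<forall>\<alpha>\<in>A. 0 \<le> b \<alpha>) \<and> Q_payment n F G mu r b \<le> ennreal B"

definition Q_optimal :: "nat \<Rightarrow> (real^'d) set \<Rightarrow> (real^'d) measure \<Rightarrow> ((real^'d) \<times> real) measure
    \<Rightarrow> ((real^'d) \<times> real \<Rightarrow> real) \<Rightarrow> (real^'d \<Rightarrow> real) \<Rightarrow> real^'d \<Rightarrow> real \<Rightarrow> (real^'d \<Rightarrow> real) \<Rightarrow> bool" where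
  "Q_optimal n A F G mu r w B b \<longleftrightarrow>
     Q_feasible n A F G mu r B b \<and>
     (\<forall>b'. Q_feasible n A F G mu r B b' \<longrightarrow> Q_objective n F G mu r w b' \<le> Q_objective n F G mu r w b)"

definition q_dual :: "nat \<Rightarrow> (real^'d) measure \<Rightarrow> ((real^'d) \<times> real) measure \<Rightarrow> ((real^'d) \<times> real \<Rightarrow> real)
    \<Rightarrow> (real^'d \<Rightarrow> real) \<Rightarrow> real^'d \<Rightarrow> real \<Rightarrow> real \<Rightarrow> real" where
  "q_dual n F G mu r w B t =
     (1 + t) * (\<integral>\<alpha>. (if (w \<bullet> \<alpha>) / (1 + t) \<ge> r \<alpha> then 1 else 0) *
                     (LBINT s:{r \<alpha>..(w \<bullet> \<alpha>) / (1 + t)}. H_fun n G mu \<alpha> s) \<partial>F)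
     + t * B"

end

theory Submission
  imports Defs
begin

text \<open>For an item with reserve price \<open>\<rho>\<close>, the surplus \<open>\<integral>\<^sub>\<rho>\<^sup>x H\<close> is a convex function of the (paced) value
  \<open>x\<close> with subgradient \<open>H\<close>. This single inequality says both that the shaded bid is a best response
  in the first-price auction and that \<open>(1 + t)\<close> times the surplus at \<open>v / (1 + t)\<close> is convex in the
  multiplier \<open>t\<close>, with minus the expected payment as subgradient. Comparing a dual minimizer with
  nearby multipliers and passing to the limit gives feasibility and complementary slackness, and weak
  duality then gives optimality.

  The limit needs that, for almost every item, values have no atoms and the buyer's paced value does
  not equal the reserve price. Both exceptional events are of the form \<open>p(x) \<bullet> v = h(x)\<close>; for different
  \<open>v\<close> these events meet in a null hyperplane, so only countably many \<open>v\<close> give an event of positive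
  probability, and the lines spanned by these \<open>v\<close> form a null set in dimension at least two. Since
  reserve prices do not depend on the pacing function, neither does the excluded set of buyer types.\<close>

section \<open>Surplus and shading for a monotone distribution function\<close>

text \<open>\<open>sigma_fun\<close> with the law of the highest competing value abstracted to
  \<open>H\<close>: the equilibrium bid at value \<open>x\<close> in a first-price auction with
  reserve \<open>\<rho>\<close>.\<close>

definition shade :: "(real \<Rightarrow> real) \<Rightarrow> real \<Rightarrow> real \<Rightarrow> real" where
  "shade H \<rho> x = (if x < \<rho> then x else if H x > 0 then x - (LBINT s:{\<rho>..x}. H s / H x) else \<rho>)"

text \<open>The equilibrium utility of value \<open>x\<close> by the envelope formula. The indicator
  is written as a factor so that the term matches the integrand of \<open>q_dual\<close>.\<close>

definition surplus :: "(real \<Rightarrow> real) \<Rightarrow> real \<Rightarrow> real \<Rightarrow> real" where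
  "surplus H \<rho> x = (if x \<ge> \<rho> then 1 else 0) * (LBINT s:{\<rho>..x}. H s)"

text \<open>The winning probability of value \<open>x\<close>, which serves as subgradient of
  \<open>surplus H \<rho>\<close> at \<open>x\<close>; it can jump at \<open>\<rho>\<close>.\<close>

definition slope :: "(real \<Rightarrow> real) \<Rightarrow> real \<Rightarrow> real \<Rightarrow> real" where
  "slope H \<rho> x = (if x \<ge> \<rho> then H x else 0)"

locale mono_cdf =
  fixes H :: "real \<Rightarrow> real"
  assumes mono_H: "mono H" and H_nonneg: "0 \<le> H x" and H_le_1: "H x \<le> 1"
begin

lemma H_le: "x \<le> y \<Longrightarrow> H x \<le> H y"
  using mono_H by (rule monoD)

lemma set_integrable_H: "set_integrable lborel {a..b} H"
  unfolding set_integrable_def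
proof (rule integrableI_bounded_set_indicator[where B=1])
  show "H \<in> borel_measurable lborel"
    using borel_measurable_mono[OF mono_H] by simp
  show "emeasure lborel {a..b} < \<infinity>" by (auto simp: emeasure_lborel_Icc_eq)
  show "AE x in lborel. x \<in> {a..b} \<longrightarrow> norm (H x) \<le> 1"
    using H_nonneg H_le_1 by simp
qed simp

lemma LBINT_combine:
  assumes "a \<le> b" "b \<le> c"
  shows "(LBINT s:{a..c}. H s) = (LBINT s:{a..b}. H s) + (LBINT s:{b..c}. H s)"
proof -
  have "H integrable_on {a..c}"
    by (rule set_borel_integral_eq_integral(1)[OF set_integrable_H])
  from Henstock_Kurzweil_Integration.integral_combine[OF assms this] show ?thesis
    by (simp add: set_borel_integral_eq_integral(2)[OF set_integrable_H])
qed

lemma LBINT_bounds: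
  assumes "a \<le> b"
  shows "H a * (b - a) \<le> (LBINT s:{a..b}. H s)" "(LBINT s:{a..b}. H s) \<le> H b * (b - a)"
proof -
  have c: "(LBINT s:{a..b}. c) = c * (b - a)" "set_integrable lborel {a..b} (\<lambda>_. c)" for c :: real
    using assms by (auto simp: set_lebesgue_integral_def set_integrable_def)
  have "(LBINT s:{a..b}. H a) \<le> (LBINT s:{a..b}. H s)"
    by (rule set_integral_mono[OF c(2) set_integrable_H]) (auto intro: H_le)
  then show "H a * (b - a) \<le> (LBINT s:{a..b}. H s)" by (simp add: c)
  have "(LBINT s:{a..b}. H s) \<le> (LBINT s:{a..b}. H b)"
    by (rule set_integral_mono[OF set_integrable_H c(2)]) (auto intro: H_le)
  then show "(LBINT s:{a..b}. H s) \<le> H b * (b - a)" by (simp add: c)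
qed

lemma surplus_nonneg: "0 \<le> surplus H \<rho> x"
  using LBINT_bounds(1)[of \<rho> x] H_nonneg[of \<rho>]
  by (auto simp: surplus_def intro: order_trans[rotated])

lemma slope_bounds: "0 \<le> slope H \<rho> x" "slope H \<rho> x \<le> 1"
  using H_nonneg H_le_1 by (auto simp: slope_def)

text \<open>Monotonicity of \<open>H\<close> compares the integral between \<open>x\<close> and
  \<open>z\<close> with the rectangle of height \<open>H x\<close>.\<close>

lemma surplus_subgradient: "surplus H \<rho> x + slope H \<rho> x * (z - x) \<le> surplus H \<rho> z"
proof -
  consider "x < \<rho>" | "\<rho> \<le> x" "x \<le> z" | "\<rho> \<le> z" "z \<le> x" | "z < \<rho>" "\<rho> \<le> x" by linarith
  then show ?thesis
  proof cases
    case 1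
    then show ?thesis using surplus_nonneg[of \<rho> z] by (simp add: surplus_def slope_def)
  next
    case 2
    then show ?thesis using LBINT_combine[of \<rho> x z] LBINT_bounds(1)[of x z]
      by (simp add: surplus_def slope_def)
  next
    case 3
    then show ?thesis using LBINT_combine[of \<rho> z x] LBINT_bounds(2)[of z x]
      by (simp add: surplus_def slope_def algebra_simps)
  next
    case 4
    \<comment> \<open>The surplus at \<open>z\<close> is zero and that at \<open>x\<close> is at
      most \<open>H x * (x - \<rho>)\<close>; moving \<open>z\<close> further below the reserve only
      enlarges the rectangle.\<close>
    have "H x * (x - \<rho>) \<le> H x * (x - z)"
      using 4 H_nonneg[of x] by (intro mult_left_mono) auto
    with 4 show ?thesis using LBINT_bounds(2)[of \<rho> x]
      by (simp add: surplus_def slope_def algebra_simps)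
  qed
qed

text \<open>Subgradients lie in [0, 1]; the subgradient inequality is used once from each end
  point.\<close>

lemma surplus_lipschitz: "\<bar>surplus H \<rho> z - surplus H \<rho> x\<bar> \<le> \<bar>z - x\<bar>"
proof -
  have "slope H \<rho> y * u \<le> \<bar>u\<bar>" "- \<bar>u\<bar> \<le> slope H \<rho> y * u" for y u
    using slope_bounds[of \<rho> y] mult_right_mono[of "slope H \<rho> y" 1 "\<bar>u\<bar>"]
      abs_mult[of "slope H \<rho> y" u] by linarith+
  from this(1)[where y=z and u="z - x"] this(2)[where y=x and u="z - x"] show ?thesis
    using surplus_subgradient[of \<rho> x z] surplus_subgradient[of \<rho> z x]
    by (auto simp: algebra_simps abs_le_iff)
qed

lemma isCont_surplus: "isCont (surplus H \<rho>) x"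
proof -
  have "((\<lambda>z. surplus H \<rho> z - surplus H \<rho> x) \<longlongrightarrow> 0) (at x)"
  proof (rule Lim_null_comparison)
    show "((\<lambda>z. \<bar>z - x\<bar>) \<longlongrightarrow> 0) (at x)"
      by (auto intro!: tendsto_eq_intros)
    show "\<forall>\<^sub>F z in at x. norm (surplus H \<rho> z - surplus H \<rho> x) \<le> \<bar>z - x\<bar>"
      using surplus_lipschitz by simp
  qed
  then show ?thesis by (simp add: isCont_def LIM_zero_iff)
qed

lemma isCont_slope:
  assumes "isCont H x" "x \<noteq> \<rho>"
  shows "isCont (slope H \<rho>) x"
proof (cases "x < \<rho>")
  case True
  then have "\<forall>\<^sub>F y in nhds x. slope H \<rho> y = 0"
    using eventually_nhds_in_open[of "{..<\<rho>}" x]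
    by (auto simp: slope_def elim: eventually_mono)
  then show ?thesis by (subst isCont_cong) auto
next
  case False
  with assms have "x > \<rho>" by auto
  then have "\<forall>\<^sub>F y in nhds x. slope H \<rho> y = H y"
    using eventually_nhds_in_open[of "{\<rho><..}" x]
    by (auto simp: slope_def elim: eventually_mono)
  with assms(1) show ?thesis by (subst isCont_cong) auto
qed

text \<open>Expected payment is expected value won minus surplus. For \<open>H x = 0\<close> the
  surplus is squeezed to zero by \<open>H x * (x - \<rho>)\<close>, so both sides vanish and the
  division in \<open>shade\<close> does no harm.\<close>

lemma shade_times_slope: "shade H \<rho> x * slope H \<rho> x = x * slope H \<rho> x - surplus H \<rho> x"
proof (cases "x < \<rho>")
  case False
  show ?thesis
  proof (cases "H x > 0")
    case True
    have "(LBINT s:{\<rho>..x}. H s / H x) = (LBINT s:{\<rho>..x}. H s) / H x" by simp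
    with True False show ?thesis
      by (simp add: shade_def slope_def surplus_def algebra_simps)
  next
    case H0: False
    then have "H x = 0" using H_nonneg[of x] by auto
    moreover from this False have "surplus H \<rho> x \<le> 0"
      using LBINT_bounds(2)[of \<rho> x] by (simp add: surplus_def)
    ultimately show ?thesis using surplus_nonneg[of \<rho> x] by (simp add: slope_def)
  qed
qed (simp add: slope_def surplus_def)

lemma shade_bounds:
  assumes "\<rho> \<le> x"
  shows "\<rho> \<le> shade H \<rho> x" "shade H \<rho> x \<le> x"
proof -
  have *: "\<rho> \<le> shade H \<rho> x \<and> shade H \<rho> x \<le> x" if h: "H x > 0"
  proof -
    have "\<rho> * H x \<le> shade H \<rho> x * H x"
      using shade_times_slope[of \<rho> x] assms LBINT_bounds(2)[of \<rho> x]
      by (simp add: slope_def surplus_def algebra_simps)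
    moreover have "shade H \<rho> x * H x \<le> x * H x"
      using shade_times_slope[of \<rho> x] assms surplus_nonneg[of \<rho> x] by (simp add: slope_def)
    ultimately show ?thesis using h by simp
  qed
  show "\<rho> \<le> shade H \<rho> x" "shade H \<rho> x \<le> x"
    using * assms by (cases "H x > 0"; simp add: shade_def)+
qed

text \<open>In the main case the subgradient at \<open>z\<close>, evaluated at \<open>y\<close>,
  bounds the payment of \<open>z\<close> from below by that of \<open>y\<close> plus
  \<open>y * (H z - H y)\<close>. Since \<open>shade H \<rho> y \<le> y\<close>, this is at least
  \<open>shade H \<rho> y * H z\<close>, and \<open>H z\<close> cancels.\<close>

lemma mono_shade: "mono (shade H \<rho>)"
proof (rule monoI)
  fix y z :: real assume yz: "y \<le> z"
  consider "z < \<rho>" | "y < \<rho>" "\<rho> \<le> z" | "\<rho> \<le> y" "H y = 0" | "\<rho> \<le> y" "H y > 0"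
    using H_nonneg[of y] by linarith
  then show "shade H \<rho> y \<le> shade H \<rho> z"
  proof cases
    case 1 then show ?thesis using yz by (simp add: shade_def)
  next
    case 2 then show ?thesis using shade_bounds(1)[of \<rho> z] by (simp add: shade_def)
  next
    case 3 then show ?thesis using shade_bounds(1)[of \<rho> z] yz by (simp add: shade_def)
  next
    case 4
    then have hz: "H z > 0" using H_le[OF yz] by linarith
    have "shade H \<rho> y * H y + y * (H z - H y) \<le> shade H \<rho> z * H z"
      using shade_times_slope[of \<rho> y] shade_times_slope[of \<rho> z] 4 yz
        surplus_subgradient[of \<rho> z y]
      by (simp add: slope_def algebra_simps)
    moreover have "shade H \<rho> y * (H z - H y) \<le> y * (H z - H y)"
      using shade_bounds(2)[of \<rho> y] 4 H_le[OF yz] by (intro mult_right_mono) auto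
    ultimately have "shade H \<rho> y * H z \<le> shade H \<rho> z * H z" by (simp add: algebra_simps)
    with hz show ?thesis by simp
  qed
qed

text \<open>The best-response property. A bid that matches the shaded bid of \<open>y\<close> earns
  value \<open>x\<close> no more than imitating \<open>y\<close> would, and imitation earns the
  tangent to the surplus at \<open>y\<close>, evaluated at \<open>x\<close>.\<close>

lemma bid_below_value_surplus:
  assumes "\<rho> \<le> b" "shade H \<rho> y \<le> b"
  shows "(x - b) * H y \<le> surplus H \<rho> x"
proof (cases "x < b")
  case True
  then have "(x - b) * H y \<le> 0" using H_nonneg[of y] by (simp add: mult_nonpos_nonneg)
  then show ?thesis using surplus_nonneg[of \<rho> x] by simp
next
  case xb: False
  have *: "(x - b) * H y \<le> surplus H \<rho> x" if "\<rho> \<le> y" "shade H \<rho> y \<le> b" for y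
  proof -
    have "(x - b) * H y \<le> (x - shade H \<rho> y) * H y"
      using that(2) H_nonneg by (intro mult_right_mono) auto
    also have "\<dots> = surplus H \<rho> y + slope H \<rho> y * (x - y)"
      using shade_times_slope[of \<rho> y] that(1) by (simp add: slope_def algebra_simps)
    also have "\<dots> \<le> surplus H \<rho> x" by (rule surplus_subgradient)
    finally show ?thesis .
  qed
  show ?thesis
  proof (cases "\<rho> \<le> y")
    case True then show ?thesis using * assms by blast
  next
    case False
    \<comment> \<open>A \<open>y\<close> below the reserve is replaced by \<open>\<rho>\<close>:
      this only raises \<open>H\<close>, and the shaded bid of \<open>\<rho>\<close> is still at
      most \<open>b\<close>.\<close>
    then have "(x - b) * H y \<le> (x - b) * H \<rho>"
      using xb by (intro mult_left_mono H_le) auto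
    also have "\<dots> \<le> surplus H \<rho> x"
      using shade_bounds(2)[of \<rho> \<rho>] assms(1) by (intro *) auto
    finally show ?thesis .
  qed
qed

text \<open>Continuity from the left gives some \<open>y\<close> strictly between
  \<open>\<rho>\<close> and \<open>x\<close> with \<open>H y > 0\<close>, which makes the surplus at
  \<open>x\<close> positive. If \<open>H x = 0\<close>, the default bid \<open>\<rho>\<close> is
  already below \<open>x\<close>. Strictness later allows the profit margin to be cancelled.\<close>

lemma shade_less:
  assumes "isCont H x" "\<rho> < x"
  shows "shade H \<rho> x < x"
proof (cases "H x > 0")
  case True
  have "\<forall>\<^sub>F y in at_left x. H y > 0"
    using assms(1) True by (intro order_tendstoD) (auto simp: isCont_def filterlim_at_split)
  moreover have "\<forall>\<^sub>F y in at_left x. y \<in> {\<rho><..<x}"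
    using assms(2) by (rule eventually_at_left_real)
  ultimately have "\<forall>\<^sub>F y in at_left x. H y > 0 \<and> y \<in> {\<rho><..<x}" by eventually_elim simp
  then obtain y where y: "H y > 0" "\<rho> < y" "y < x"
    using eventually_happens[of _ "at_left x"] trivial_limit_at_left_real by fastforce
  then have "0 < slope H \<rho> y * (x - y)" by (simp add: slope_def)
  then have "0 < surplus H \<rho> x"
    using surplus_subgradient[of \<rho> y x] surplus_nonneg[of \<rho> y] by linarith
  then have "shade H \<rho> x * H x < x * H x"
    using shade_times_slope[of \<rho> x] assms(2) by (simp add: slope_def)
  with True show ?thesis by simp
next
  case False
  with assms(2) show ?thesis by (simp add: shade_def)
qed

end

section \<open>Winning probabilities on down-closed sets of competing values\<close>

lemma downset_exhaustion:
  fixes D :: "real set"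
  assumes down: "\<And>x y. y \<in> D \<Longrightarrow> x \<le> y \<Longrightarrow> x \<in> D" and "D \<noteq> {}"
  obtains Y :: "nat \<Rightarrow> real" where "\<And>i. Y i \<in> D" "incseq Y" "D = (\<Union>i. {..Y i})"
proof -
  have "\<exists>Y::nat \<Rightarrow> real. (\<forall>i. Y i \<in> D) \<and> incseq Y \<and> (\<forall>z\<in>D. \<exists>i. z \<le> Y i)"
  \<comment> \<open>A nonempty down-set of reals is the whole line, a closed half-line or an open
    half-line; each is exhausted by closed half-lines.\<close>
  proof (cases "bdd_above D")
    case False
    have D: "real i \<in> D" for i
    proof (rule ccontr)
      assume "real i \<notin> D"
      then have "z \<le> real i" if "z \<in> D" for z using down[OF that, of "real i"] by linarith
      then have "bdd_above D" by (rule bdd_aboveI)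
      with False show False ..
    qed
    show ?thesis
    proof (intro exI[of _ real] conjI allI ballI D real_arch_simple)
      show "incseq real" by (rule incseq_SucI) simp
    qed
  next
    case bdd: True
    show ?thesis
    proof (cases "Sup D \<in> D")
      case True
      show ?thesis
      proof (intro exI[of _ "\<lambda>_. Sup D"] conjI allI ballI True exI)
        show "incseq (\<lambda>_. Sup D)" by (rule incseq_SucI) simp
        show "z \<le> Sup D" if "z \<in> D" for z by (rule cSup_upper[OF that bdd])
      qed
    next
      case False
      have lt: "z < Sup D" if "z \<in> D" for z
        using cSup_upper[OF that bdd] False that by (cases "z = Sup D") auto
      let ?Y = "\<lambda>i. Sup D - inverse (real (Suc i))"
      show ?thesis
      proof (intro exI[of _ ?Y] conjI allI ballI)
        fix i
        have "?Y i < Sup D" by simp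
        then obtain z where "z \<in> D" "?Y i < z"
          using less_cSup_iff[OF \<open>D \<noteq> {}\<close> bdd, of "?Y i"] by blast
        then show "?Y i \<in> D" using down[of z "?Y i"] by simp
      next
        show "incseq ?Y"
          by (intro incseq_SucI diff_left_mono le_imp_inverse_le) auto
      next
        fix z assume "z \<in> D"
        then have "0 < Sup D - z" using lt by simp
        from reals_Archimedean[OF this] obtain i where "inverse (real (Suc i)) < Sup D - z" ..
        then have "z \<le> ?Y i" by linarith
        then show "\<exists>i. z \<le> ?Y i" ..
      qed
    qed
  qed
  then obtain Y :: "nat \<Rightarrow> real" where Y: "\<And>i. Y i \<in> D" "incseq Y" "\<And>z. z \<in> D \<Longrightarrow> \<exists>i. z \<le> Y i"
    by (elim exE conjE) blast
  have "D = (\<Union>i. {..Y i})"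
  proof (intro equalityI subsetI)
    show "z \<in> (\<Union>i. {..Y i})" if "z \<in> D" for z using Y(3)[OF that] by simp
    show "z \<in> D" if "z \<in> (\<Union>i. {..Y i})" for z using that down[OF Y(1)] by (elim UN_E) simp
  qed
  with Y(1,2) show thesis by (rule that)
qed

text \<open>Distribution functions only measure sets \<open>{..y}\<close>, whereas the values beaten
  by a bid form a general down-set. Continuity from below carries the bound over; being a limit of
  reals, the argument works for either sign of \<open>c\<close>.\<close>

lemma (in real_distribution) downset_power_le:
  fixes D :: "real set" and c K :: real
  assumes down: "\<And>x y. y \<in> D \<Longrightarrow> x \<le> y \<Longrightarrow> x \<in> D" and "D \<noteq> {}"
    and bound: "\<And>y. y \<in> D \<Longrightarrow> c * measure M {..y} ^ k \<le> K"
  shows "c * measure M D ^ k \<le> K"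
proof -
  obtain Y :: "nat \<Rightarrow> real" where Y: "\<And>i. Y i \<in> D" "incseq Y" "D = (\<Union>i. {..Y i})"
    by (rule downset_exhaustion[OF down \<open>D \<noteq> {}\<close>]) (assumption, assumption, blast)
  have "(\<lambda>i. measure M {..Y i}) \<longlonglongrightarrow> measure M (\<Union>i. {..Y i})"
  proof (rule finite_Lim_measure_incseq)
    show "incseq (\<lambda>i. {..Y i})"
      using Y(2) by (simp add: incseq_def)
  qed auto
  then have "(\<lambda>i. c * measure M {..Y i} ^ k) \<longlonglongrightarrow> c * measure M D ^ k"
    unfolding Y(3)[symmetric] by (intro tendsto_intros)
  then show ?thesis
    by (rule LIMSEQ_le_const2) (simp add: bound Y(1))
qed

locale power_cdf = real_distribution M for M :: "real measure" +
  fixes k :: nat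
begin

text \<open>The distribution function of the maximum of \<open>k\<close> independent draws from
  \<open>M\<close>; \<open>k\<close> will be \<open>n - 1\<close>.\<close>

definition "pcdf x = measure M {..x} ^ k"

lemma mono_cdf_pcdf: "mono_cdf pcdf"
proof
  show "mono pcdf"
    unfolding pcdf_def by (intro monoI power_mono finite_measure_mono) auto
qed (auto simp: pcdf_def intro: power_le_one)

sublocale mono_cdf pcdf by (rule mono_cdf_pcdf)

text \<open>Monotone shading makes the set of values beaten by \<open>b\<close> a down-set, so the
  best-response bound for single \<open>y\<close> extends to the true winning probability, ties
  included.\<close>

lemma win_surplus_le:
  assumes "\<rho> \<le> b"
  shows "(x - b) * measure M {y. shade pcdf \<rho> y \<le> b} ^ k \<le> surplus pcdf \<rho> x"
proof (rule downset_power_le)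
  show "x \<in> {y. shade pcdf \<rho> y \<le> b}" if "y \<in> {y. shade pcdf \<rho> y \<le> b}" "x \<le> y" for x y
    using that monoD[OF mono_shade that(2), of \<rho>] by auto
  show "{y. shade pcdf \<rho> y \<le> b} \<noteq> {}"
  proof -
    have "\<rho> \<in> {y. shade pcdf \<rho> y \<le> b}"
      using shade_bounds(2)[of \<rho> \<rho>] assms by simp
    then show ?thesis by blast
  qed
  show "(x - b) * measure M {..y} ^ k \<le> surplus pcdf \<rho> x" if "y \<in> {y. shade pcdf \<rho> y \<le> b}" for y
    using bid_below_value_surplus[OF assms, of y x] that by (simp add: pcdf_def)
qed

text \<open>Shading may be flat, so the bid of \<open>x\<close> could also beat values above
  \<open>x\<close>. Such extra wins would earn more than \<open>surplus pcdf \<rho> x\<close>,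
  against the best-response bound; the margin \<open>x - shade pcdf \<rho> x\<close> is positive and
  cancels.\<close>

lemma win_prob_shade:
  assumes "isCont pcdf x" "\<rho> < x"
  shows "measure M {y. shade pcdf \<rho> y \<le> shade pcdf \<rho> x} ^ k = pcdf x" (is "?p = _")
proof (rule antisym)
  have "(x - shade pcdf \<rho> x) * ?p \<le> surplus pcdf \<rho> x"
    using assms(2) by (intro win_surplus_le shade_bounds) auto
  also have "\<dots> = (x - shade pcdf \<rho> x) * pcdf x"
    using shade_times_slope[of \<rho> x] assms(2) by (simp add: slope_def algebra_simps)
  finally show "?p \<le> pcdf x"
    using shade_less[OF assms] by simp
  have [measurable]: "shade pcdf \<rho> \<in> borel_measurable borel"
    by (rule borel_measurable_mono[OF mono_shade])
  have "measure M {..x} \<le> measure M {y. shade pcdf \<rho> y \<le> shade pcdf \<rho> x}"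
    by (intro finite_measure_mono) (auto intro: monoD[OF mono_shade])
  then show "pcdf x \<le> ?p"
    unfolding pcdf_def[of x] by (rule power_mono) simp
qed

end

section \<open>Hyperplanes of positive probability\<close>

text \<open>Pairwise overlaps are null, so probabilities add up over finite subfamilies and stay
  below 1. A summable family has countably many nonzero terms.\<close>

lemma (in prob_space) countable_almost_disjoint:
  fixes S :: "'i \<Rightarrow> 'a set"
  assumes [measurable]: "\<And>i. S i \<in> events"
    and disj: "\<And>i j. i \<noteq> j \<Longrightarrow> prob (S i \<inter> S j) = 0"
  shows "countable {i. prob (S i) \<noteq> 0}"
proof -
  have "(\<Sum>i\<in>T. prob (S i)) = prob (\<Union>i\<in>T. S i)" if "finite T" for T
    using that
  proof (induction T rule: finite_induct)
    case (insert i T)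
    have "prob (S i \<inter> (\<Union>j\<in>T. S j)) \<le> (\<Sum>j\<in>T. prob (S i \<inter> S j))"
      unfolding Int_UN_distrib using insert(1) by (intro finite_measure_subadditive_finite) auto
    also have "\<dots> = 0" using insert(2) by (intro sum.neutral ballI disj) auto
    finally have "prob (S i \<inter> (\<Union>j\<in>T. S j)) = 0" by (simp add: measure_le_0_iff)
    with insert show ?case
      by (simp add: measure_Un3 fmeasurable_eq_sets sets.finite_UN)
  qed simp
  then have "(\<Sum>i\<in>T. prob (S i)) \<le> 1" if "finite T" for T using that by simp
  then have "(\<lambda>i. prob (S i)) summable_on UNIV"
    by (intro nonneg_bdd_above_summable_on bdd_aboveI[of _ 1]) auto
  then have "(\<lambda>i. norm (prob (S i))) summable_on UNIV" by simp
  from abs_summable_countable[OF this] show ?thesis by simp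
qed

lemma AE_density_negligible:
  fixes f :: "'a::euclidean_space \<Rightarrow> ennreal"
  assumes "f \<in> borel_measurable lebesgue" "negligible S"
  shows "AE x in density lebesgue f. x \<notin> S"
proof -
  have "AE x in lebesgue. x \<notin> S"
    using assms(2) by (intro AE_not_in) (simp add: negligible_iff_null_sets)
  then show ?thesis using assms(1) by (auto simp: AE_density)
qed

lemma negligible_fst_hyperplane:
  fixes v :: "'a::euclidean_space"
  assumes "v \<noteq> 0"
  shows "negligible {z :: 'a \<times> 'b::euclidean_space. fst z \<bullet> v = 0}"
proof -
  have "(v, 0) \<bullet> z = fst z \<bullet> v" for z :: "'a \<times> 'b"
    by (cases z) (simp add: inner_commute)
  then show ?thesis
    using negligible_hyperplane[of "(v, 0 :: 'b)" 0] assms by (simp add: zero_prod_def)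
qed

lemma span_singleton_subset_hyperplane:
  fixes v :: "'a::euclidean_space"
  assumes "DIM('a) \<ge> 2"
  obtains u where "u \<noteq> 0" "span {v} \<subseteq> {x. u \<bullet> x = 0}"
proof -
  obtain u where "u \<noteq> 0" "orthogonal v u"
    using orthogonal_to_vector_exists[OF assms] by blast
  then show ?thesis
    by (intro that[of u]) (auto simp: span_singleton orthogonal_def inner_commute[of u v])
qed

text \<open>In dimension at least two each line lies in a hyperplane. The first form removes item
  types, the second removes buyer types through their value vector alone.\<close>

lemma negligible_rays:
  fixes V :: "'a::euclidean_space set"
  assumes "DIM('a) \<ge> 2" "countable V"
  shows "negligible (\<Union>v\<in>V. span {v})"
    and "negligible ((\<Union>v\<in>V. span {v}) \<times> (UNIV :: 'b::euclidean_space set))"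
proof -
  have *: "negligible (span {v})" "negligible (span {v} \<times> (UNIV :: 'b set))" for v :: 'a
  proof -
    obtain u where u: "u \<noteq> 0" "span {v} \<subseteq> {x. u \<bullet> x = 0}"
      using span_singleton_subset_hyperplane[OF assms(1)] .
    show "negligible (span {v})"
      by (rule negligible_subset[OF negligible_hyperplane u(2)]) (use u(1) in simp)
    show "negligible (span {v} \<times> (UNIV :: 'b set))"
      by (rule negligible_subset[OF negligible_fst_hyperplane[OF u(1)]])
        (use u(2) in \<open>force simp: inner_commute\<close>)
  qed
  then show "negligible (\<Union>v\<in>V. span {v})"
    using assms(2) by (intro negligible_countable_Union) auto
  have "negligible (\<Union>v\<in>V. span {v} \<times> (UNIV :: 'b set))"
    using assms(2) * by (intro negligible_countable_Union) auto
  then show "negligible ((\<Union>v\<in>V. span {v}) \<times> (UNIV :: 'b set))"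
    by (rule negligible_subset) blast
qed

text \<open>For \<open>v \<noteq> v'\<close> the two events meet inside
  \<open>p x \<bullet> (v - v') = 0\<close>, which is null under a density. It is applied with
  \<open>p\<close> the identity on items and with \<open>p = fst\<close> on buyer types.\<close>

lemma countable_positive_hyperplanes:
  fixes p :: "'b::euclidean_space \<Rightarrow> 'a::euclidean_space" and h :: "'b \<Rightarrow> real"
  assumes f: "f \<in> borel_measurable lebesgue" and M: "M = density lebesgue f" "prob_space M"
    and h: "h \<in> borel_measurable M" and p: "p \<in> borel_measurable M"
    and null: "\<And>v. v \<noteq> 0 \<Longrightarrow> negligible {x. p x \<bullet> v = 0}"
  shows "countable {v. measure M {x. p x \<bullet> v = h x} \<noteq> 0}"
proof -
  interpret prob_space M by fact
  note [measurable] = h p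
  have space: "space M = UNIV" by (simp add: M(1))
  have ev: "{x. p x \<bullet> v = h x} \<in> events" for v
  proof -
    have "{x \<in> space M. p x \<bullet> v = h x} \<in> events" by measurable
    then show ?thesis by (simp add: space)
  qed
  show ?thesis
  proof (rule countable_almost_disjoint[OF ev])
    fix v v' :: 'a assume "v \<noteq> v'"
    have "AE x in M. x \<notin> {x. p x \<bullet> (v - v') = 0}"
      unfolding M(1) using \<open>v \<noteq> v'\<close> by (intro AE_density_negligible f null) simp
    then have "AE x in M. x \<notin> {x. p x \<bullet> v = h x} \<inter> {x. p x \<bullet> v' = h x}"
      by eventually_elim (auto simp: inner_diff_right)
    then show "prob ({x. p x \<bullet> v = h x} \<inter> {x. p x \<bullet> v' = h x}) = 0"
      using ev by (intro prob_eq_0[THEN iffD2]) auto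
  qed
qed

section \<open>The auction for a fixed bid\<close>

lemma shade_eq: "shade H \<rho> x = (if x < \<rho> then x else if H x > 0 then x - surplus H \<rho> x / H x else \<rho>)"
  by (simp add: shade_def surplus_def)

lemma sigma_fun_eq_shade: "sigma_fun n G mu r \<alpha> = shade (H_fun n G mu \<alpha>) (r \<alpha>)"
  by (rule ext) (simp add: sigma_fun_def shade_def)

lemma measurable_lebesgue_borelI:
  fixes M :: "'a::euclidean_space measure"
  assumes "sets M = sets lebesgue" "h \<in> borel \<rightarrow>\<^sub>M N"
  shows "h \<in> M \<rightarrow>\<^sub>M N"
proof -
  have "h \<in> lebesgue \<rightarrow>\<^sub>M N"
    using assms(2) by (intro measurable_completion) simp
  then show ?thesis by (simp only: measurable_cong_sets[OF assms(1) refl])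
qed

locale auction = F: prob_space F + G: prob_space G
  for F :: "(real^'d) measure" and G :: "((real^'d) \<times> real) measure" +
  fixes n :: nat and mu :: "(real^'d) \<times> real \<Rightarrow> real" and r :: "real^'d \<Rightarrow> real"
  assumes sets_F [measurable_cong]: "sets F = sets lebesgue"
    and sets_G [measurable_cong]: "sets G = sets lebesgue"
    and mu_meas [measurable]: "mu \<in> borel_measurable G"
    and r_meas [measurable]: "r \<in> borel_measurable F"
begin

text \<open>Otherwise the simplifier turns the index set \<open>{..<n - 1}\<close> into \<open>{..<n - Suc 0}\<close>.\<close>

declare One_nat_def [simp del]

abbreviation "H \<equiv> H_fun n G mu"
abbreviation "L \<equiv> lambda_dist G mu"
abbreviation "P \<equiv> PiM {..<n - 1} (\<lambda>_. G)"

sublocale P: prob_space P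
  by (intro prob_space_PiM G.prob_space_axioms)

sublocale FP: pair_sigma_finite F P ..

lemma space_F [simp]: "space F = UNIV"
  using sets_eq_imp_space_eq[OF sets_F] by simp

lemma space_G [simp]: "space G = UNIV"
  using sets_eq_imp_space_eq[OF sets_G] by simp

section \<open>Joint measurability in item and value\<close>

lemma id_borel_F [measurable]: "(\<lambda>\<alpha>. \<alpha>) \<in> F \<rightarrow>\<^sub>M borel"
  by (rule measurable_lebesgue_borelI[OF sets_F]) simp

lemma fst_borel_G [measurable]: "fst \<in> G \<rightarrow>\<^sub>M borel"
  by (rule measurable_lebesgue_borelI[OF sets_G]) (simp add: borel_prod[symmetric])

lemma value_measurable [measurable]:
  "(\<lambda>z. (fst (snd z) \<bullet> fst z) / (1 + mu (snd z))) \<in> borel_measurable (F \<Otimes>\<^sub>M G)"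
  by measurable

lemma value_measurable_G [measurable]: "(\<lambda>\<theta>. (fst \<theta> \<bullet> \<alpha>) / (1 + mu \<theta>)) \<in> borel_measurable G"
  by measurable

lemma real_distribution_L: "real_distribution (L \<alpha>)"
  unfolding lambda_dist_def by (rule G.real_distribution_distr) simp

lemma measure_L:
  assumes "S \<in> sets borel"
  shows "measure (L \<alpha>) S = measure G {\<theta>. (fst \<theta> \<bullet> \<alpha>) / (1 + mu \<theta>) \<in> S}"
  using assms unfolding lambda_dist_def by (simp add: measure_distr vimage_def)

text \<open>The distribution function is rewritten as an integral of an indicator over
  \<open>G\<close>, so that measurability of parameter integrals applies.\<close>

lemma H_measurable [measurable]: "(\<lambda>z. H (fst z) (snd z)) \<in> borel_measurable (F \<Otimes>\<^sub>M borel)"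
proof -
  have eq: "measure (L (fst z)) {..snd z} =
      (\<integral>\<theta>. (if (fst \<theta> \<bullet> fst z) / (1 + mu \<theta>) \<le> snd z then 1 else 0) \<partial>G)" for z
  proof -
    have "measure (L (fst z)) {..snd z}
        = measure G {\<theta> \<in> space G. (fst \<theta> \<bullet> fst z) / (1 + mu \<theta>) \<le> snd z}"
      by (simp add: measure_L)
    also have "\<dots> = (\<integral>\<theta>. indicator {\<theta> \<in> space G. (fst \<theta> \<bullet> fst z) / (1 + mu \<theta>) \<le> snd z} \<theta> \<partial>G)"
      by simp
    also have "\<dots> = (\<integral>\<theta>. (if (fst \<theta> \<bullet> fst z) / (1 + mu \<theta>) \<le> snd z then 1 else 0) \<partial>G)"
      by (intro Bochner_Integration.integral_cong) (auto simp: indicator_def)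
    finally show ?thesis .
  qed
  have "(\<lambda>z. \<integral>\<theta>. (if (fst \<theta> \<bullet> fst z) / (1 + mu \<theta>) \<le> snd z then 1 else 0 :: real) \<partial>G)
      \<in> borel_measurable (F \<Otimes>\<^sub>M borel)"
    by (intro G.borel_measurable_lebesgue_integral) measurable
  then show ?thesis unfolding H_fun_def eq by simp
qed

lemma surplus_measurable [measurable]:
  "(\<lambda>z. surplus (H (fst z)) (r (fst z)) (snd z)) \<in> borel_measurable (F \<Otimes>\<^sub>M borel)"
proof -
  have "(\<lambda>z. \<integral>s. (if r (fst z) \<le> s \<and> s \<le> snd z then 1 else 0) *\<^sub>R H (fst z) s \<partial>lborel)
      \<in> borel_measurable (F \<Otimes>\<^sub>M borel)"
  proof (intro lborel.borel_measurable_lebesgue_integral)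
    have [measurable]: "(\<lambda>p. H (fst (fst p)) (snd p)) \<in> borel_measurable ((F \<Otimes>\<^sub>M borel) \<Otimes>\<^sub>M lborel)"
    proof -
      have "(\<lambda>p. (fst (fst p), snd p)) \<in> (F \<Otimes>\<^sub>M borel) \<Otimes>\<^sub>M lborel \<rightarrow>\<^sub>M F \<Otimes>\<^sub>M borel"
        by measurable
      from measurable_compose[OF this H_measurable] show ?thesis by simp
    qed
    show "(\<lambda>(z, s). (if r (fst z) \<le> s \<and> s \<le> snd z then 1 else 0) *\<^sub>R H (fst z) s)
      \<in> borel_measurable ((F \<Otimes>\<^sub>M borel) \<Otimes>\<^sub>M lborel)"
      by measurable
  qed
  then show ?thesis
    unfolding surplus_def set_lebesgue_integral_def indicator_def of_bool_def atLeastAtMost_iff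
    by measurable
qed

lemma shade_measurable [measurable]:
  "(\<lambda>z. shade (H (fst z)) (r (fst z)) (snd z)) \<in> borel_measurable (F \<Otimes>\<^sub>M borel)"
  unfolding shade_eq by measurable

lemma slope_measurable [measurable]:
  "(\<lambda>z. slope (H (fst z)) (r (fst z)) (snd z)) \<in> borel_measurable (F \<Otimes>\<^sub>M borel)"
  unfolding slope_def by measurable

lemma beta_measurable [measurable]:
  "(\<lambda>z. beta_fun n G mu r (snd z) (fst z)) \<in> borel_measurable (F \<Otimes>\<^sub>M G)"
proof -
  have "(\<lambda>z. (fst z, (fst (snd z) \<bullet> fst z) / (1 + mu (snd z)))) \<in> F \<Otimes>\<^sub>M G \<rightarrow>\<^sub>M F \<Otimes>\<^sub>M borel"
    by measurable
  from measurable_compose[OF this shade_measurable] show ?thesis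
    by (simp add: beta_fun_def sigma_fun_eq_shade)
qed

lemma beta_measurable_G [measurable]: "(\<lambda>\<theta>. beta_fun n G mu r \<theta> \<alpha>) \<in> borel_measurable G"
  using measurable_compose[OF measurable_Pair1'[of \<alpha> F G] beta_measurable] by simp

lemma power_cdf_L: "power_cdf (L \<alpha>)"
  unfolding power_cdf_def by (rule real_distribution_L)

lemma pcdf_L: "power_cdf.pcdf (L \<alpha>) (n - 1) = H \<alpha>"
  by (rule ext) (simp add: power_cdf.pcdf_def[OF power_cdf_L] H_fun_def)

lemma mono_cdf_H: "mono_cdf (H \<alpha>)"
  using power_cdf.mono_cdf_pcdf[OF power_cdf_L, of \<alpha> "n - 1"] by (simp only: pcdf_L)

lemma isCont_H:
  assumes "measure (L \<alpha>) {x} = 0"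
  shows "isCont (H \<alpha>) x"
proof -
  interpret L: real_distribution "L \<alpha>" by (rule real_distribution_L)
  have "isCont (\<lambda>x. measure (L \<alpha>) {..x}) x"
    using assms L.isCont_cdf[of x] by (simp add: cdf_def[abs_def])
  then show ?thesis unfolding H_fun_def[abs_def] by (intro continuous_intros)
qed

section \<open>Winning probabilities and payments for a given item\<close>

definition bid_win :: "real^'d \<Rightarrow> real \<Rightarrow> real" where
  "bid_win \<alpha> b = measure P {\<theta>s \<in> space P. \<forall>i\<in>{..<n - 1}. beta_fun n G mu r (\<theta>s i) \<alpha> \<le> b}"

text \<open>Independence of the competitors gives a power of one probability, which is then pushed
  forward to the law \<open>L \<alpha>\<close> of a paced value.\<close>

lemma bid_win_eq: "bid_win \<alpha> b = measure (L \<alpha>) {y. shade (H \<alpha>) (r \<alpha>) y \<le> b} ^ (n - 1)"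
proof -
  let ?E = "{\<theta> \<in> space G. beta_fun n G mu r \<theta> \<alpha> \<le> b}"
  have [measurable]: "shade (H \<alpha>) (r \<alpha>) \<in> borel_measurable borel"
    by (rule borel_measurable_mono[OF mono_cdf.mono_shade[OF mono_cdf_H]])
  have "measure (L \<alpha>) {y. shade (H \<alpha>) (r \<alpha>) y \<le> b} = measure G ?E"
    by (subst measure_L) (simp_all add: beta_fun_def sigma_fun_eq_shade)
  moreover have "bid_win \<alpha> b = measure G ?E ^ (n - 1)"
  proof -
    interpret PG: finite_product_prob_space "\<lambda>_. G" "{..<n - 1}" by unfold_locales simp
    have E: "?E \<in> sets G" by measurable
    have "{\<theta>s \<in> space P. \<forall>i\<in>{..<n - 1}. beta_fun n G mu r (\<theta>s i) \<alpha> \<le> b} = PiE {..<n - 1} (\<lambda>_. ?E)"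
      unfolding space_PiM space_G by (intro set_eqI) (simp add: PiE_iff, blast)
    then have "bid_win \<alpha> b = measure P (PiE {..<n - 1} (\<lambda>_. ?E))"
      by (simp only: bid_win_def)
    also have "\<dots> = (\<Prod>i<n - 1. measure G ?E)"
      by (rule PG.prob_times) (use E in simp)
    also have "\<dots> = measure G ?E ^ (n - 1)" by simp
    finally show ?thesis .
  qed
  ultimately show ?thesis by (simp only:)
qed

lemma bid_win_le:
  "r \<alpha> \<le> b \<Longrightarrow> (x - b) * bid_win \<alpha> b \<le> surplus (H \<alpha>) (r \<alpha>) x"
  using power_cdf.win_surplus_le[OF power_cdf_L, where \<rho>="r \<alpha>" and k="n - 1"]
  by (simp only: pcdf_L bid_win_eq)

lemma bid_win_shade:
  "measure (L \<alpha>) {x} = 0 \<Longrightarrow> r \<alpha> < x \<Longrightarrow> bid_win \<alpha> (shade (H \<alpha>) (r \<alpha>) x) = H \<alpha> x"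
  using power_cdf.win_prob_shade[OF power_cdf_L, where \<rho>="r \<alpha>" and k="n - 1"]
  by (simp only: pcdf_L bid_win_eq isCont_H)

definition win_prob :: "(real^'d \<Rightarrow> real) \<Rightarrow> real^'d \<Rightarrow> real" where
  "win_prob b \<alpha> = (if r \<alpha> \<le> b \<alpha> then bid_win \<alpha> (b \<alpha>) else 0)"

abbreviation win :: "(real^'d \<Rightarrow> real) \<Rightarrow> (real^'d) \<times> (nat \<Rightarrow> (real^'d) \<times> real) \<Rightarrow> real" where
  "win b z \<equiv> (if wins n G mu r b (fst z) (snd z) then 1 else 0)"

lemma wins_iff:
  "wins n G mu r b \<alpha> \<theta>s \<longleftrightarrow> r \<alpha> \<le> b \<alpha> \<and> (\<forall>i\<in>{..<n - 1}. beta_fun n G mu r (\<theta>s i) \<alpha> \<le> b \<alpha>)"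
  unfolding wins_def by (subst Max_le_iff) auto

lemma win_measurable [measurable]:
  assumes [measurable]: "b \<in> borel_measurable F"
  shows "win b \<in> borel_measurable (F \<Otimes>\<^sub>M P)"
proof -
  have [measurable]: "(\<lambda>z. beta_fun n G mu r (snd z i) (fst z)) \<in> borel_measurable (F \<Otimes>\<^sub>M P)"
    if "i \<in> {..<n - 1}" for i
  proof -
    have "(\<lambda>z. (fst z, snd z i)) \<in> F \<Otimes>\<^sub>M P \<rightarrow>\<^sub>M F \<Otimes>\<^sub>M G"
      using that by measurable
    from measurable_compose[OF this beta_measurable] show ?thesis by simp
  qed
  show ?thesis unfolding wins_iff by measurable
qed

lemma integral_win:
  assumes [measurable]: "b \<in> borel_measurable F"
  shows "(\<integral>\<theta>s. win b (\<alpha>, \<theta>s) \<partial>P) = win_prob b \<alpha>"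
proof (cases "r \<alpha> \<le> b \<alpha>")
  case True
  have "(\<integral>\<theta>s. win b (\<alpha>, \<theta>s) \<partial>P)
      = (\<integral>\<theta>s. indicator {\<theta>s \<in> space P. \<forall>i\<in>{..<n - 1}. beta_fun n G mu r (\<theta>s i) \<alpha> \<le> b \<alpha>} \<theta>s \<partial>P)"
    using True by (intro Bochner_Integration.integral_cong) (auto simp: wins_iff indicator_def)
  with True show ?thesis
    by (simp add: win_prob_def bid_win_def Int_absorb2[OF Collect_restrict])
qed (simp add: wins_iff win_prob_def)

lemma win_section_measurable:
  assumes "b \<in> borel_measurable F"
  shows "(\<lambda>\<theta>s. win b (\<alpha>, \<theta>s)) \<in> borel_measurable P"
  using measurable_compose[OF measurable_Pair1'[of \<alpha> F P] win_measurable[OF assms]] by simp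

lemma nn_integral_win:
  assumes "b \<in> borel_measurable F"
  shows "(\<integral>\<^sup>+\<theta>s. ennreal (win b (\<alpha>, \<theta>s)) \<partial>P) = ennreal (win_prob b \<alpha>)"
proof -
  have "integrable P (\<lambda>\<theta>s. win b (\<alpha>, \<theta>s))"
    by (rule P.integrable_const_bound[where B=1])
      (use win_section_measurable[OF assms, of \<alpha>] in simp_all)
  from nn_integral_eq_integral[OF this] show ?thesis
    unfolding integral_win[OF assms] by simp
qed

text \<open>Fubini: the competitors are integrated out first, since the factor \<open>g\<close>
  depends on the item only.\<close>

lemma integral_mult_win:
  assumes "b \<in> borel_measurable F" and "integrable (F \<Otimes>\<^sub>M P) (\<lambda>z. g (fst z) * win b z)"
  shows "(\<integral>z. g (fst z) * win b z \<partial>(F \<Otimes>\<^sub>M P)) = (\<integral>\<alpha>. g \<alpha> * win_prob b \<alpha> \<partial>F)"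
    and "integrable F (\<lambda>\<alpha>. g \<alpha> * win_prob b \<alpha>)"
proof -
  have *: "(\<integral>\<theta>s. g (fst (\<alpha>, \<theta>s)) * win b (\<alpha>, \<theta>s) \<partial>P) = g \<alpha> * win_prob b \<alpha>" for \<alpha>
    using integral_win[OF assms(1), of \<alpha>] by simp
  show "(\<integral>z. g (fst z) * win b z \<partial>(F \<Otimes>\<^sub>M P)) = (\<integral>\<alpha>. g \<alpha> * win_prob b \<alpha> \<partial>F)"
    using FP.integral_fst'[OF assms(2)] unfolding * by simp
  show "integrable F (\<lambda>\<alpha>. g \<alpha> * win_prob b \<alpha>)"
    using FP.integrable_fst'[OF assms(2)] unfolding * .
qed

lemma payment_eq:
  assumes [measurable]: "b \<in> borel_measurable F" and "AE \<alpha> in F. 0 \<le> b \<alpha>"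
  shows "Q_payment n F G mu r b = (\<integral>\<^sup>+\<alpha>. ennreal (b \<alpha> * win_prob b \<alpha>) \<partial>F)"
proof -
  note [measurable] = win_measurable[OF assms(1)]
  have "Q_payment n F G mu r b = (\<integral>\<^sup>+\<alpha>. \<integral>\<^sup>+\<theta>s. ennreal (b \<alpha> * win b (\<alpha>, \<theta>s)) \<partial>P \<partial>F)"
    unfolding Q_payment_def auction_space_def
    by (subst P.nn_integral_fst[symmetric]) (simp_all add: measurable_compose[OF measurable_fst assms(1)])
  also have "\<dots> = (\<integral>\<^sup>+\<alpha>. ennreal (b \<alpha> * win_prob b \<alpha>) \<partial>F)"
  proof (rule nn_integral_cong_AE)
    show "AE \<alpha> in F. (\<integral>\<^sup>+\<theta>s. ennreal (b \<alpha> * win b (\<alpha>, \<theta>s)) \<partial>P) = ennreal (b \<alpha> * win_prob b \<alpha>)"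
      using assms(2)
    proof eventually_elim
      case (elim \<alpha>)
      have "(\<integral>\<^sup>+\<theta>s. ennreal (b \<alpha> * win b (\<alpha>, \<theta>s)) \<partial>P)
          = (\<integral>\<^sup>+\<theta>s. ennreal (b \<alpha>) * ennreal (win b (\<alpha>, \<theta>s)) \<partial>P)"
        using elim by (intro nn_integral_cong) (simp add: ennreal_mult'[symmetric])
      also have "\<dots> = ennreal (b \<alpha>) * ennreal (win_prob b \<alpha>)"
        unfolding nn_integral_win[OF assms(1), symmetric]
        by (rule nn_integral_cmult) (use win_section_measurable[OF assms(1)] in measurable)
      also have "\<dots> = ennreal (b \<alpha> * win_prob b \<alpha>)"
        using elim by (simp add: ennreal_mult')
      finally show ?case .
    qed
  qed
  finally show ?thesis .
qed

end

section \<open>Duality\<close>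

text \<open>Ties are excluded for each multiplier separately: the null set may vary with
  \<open>t\<close>, and every argument below uses it at one \<open>t\<close> only.\<close>

locale auction_buyer = auction F G n mu r
  for F :: "(real^'d) measure" and G n mu r +
  fixes w :: "real^'d" and B \<omega> :: real
  assumes r_pos: "AE \<alpha> in F. 0 < r \<alpha>"
    and value_bounds: "AE \<alpha> in F. 0 \<le> w \<bullet> \<alpha> \<and> w \<bullet> \<alpha> \<le> \<omega>"
    and atomless: "AE \<alpha> in F. \<forall>x. measure (L \<alpha>) {x} = 0"
    and no_tie: "0 \<le> t \<Longrightarrow> AE \<alpha> in F. (w \<bullet> \<alpha>) / (1 + t) \<noteq> r \<alpha>"
    and B_nonneg: "0 \<le> B"
begin

section \<open>Gain, bid, allocation and payment at a given multiplier\<close>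

abbreviation paced :: "real \<Rightarrow> real^'d \<Rightarrow> real" where
  "paced t \<alpha> \<equiv> (w \<bullet> \<alpha>) / (1 + t)"

definition gain :: "real \<Rightarrow> real^'d \<Rightarrow> real" where
  "gain t \<alpha> = surplus (H \<alpha>) (r \<alpha>) (paced t \<alpha>)"

definition bid :: "real \<Rightarrow> real^'d \<Rightarrow> real" where
  "bid t \<alpha> = shade (H \<alpha>) (r \<alpha>) (paced t \<alpha>)"

definition alloc :: "real \<Rightarrow> real^'d \<Rightarrow> real" where
  "alloc t \<alpha> = slope (H \<alpha>) (r \<alpha>) (paced t \<alpha>)"

definition pay :: "real \<Rightarrow> real^'d \<Rightarrow> real" where
  "pay t \<alpha> = bid t \<alpha> * alloc t \<alpha>"

lemma pay_eq: "pay t \<alpha> = paced t \<alpha> * alloc t \<alpha> - gain t \<alpha>"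
  unfolding pay_def bid_def alloc_def gain_def by (rule mono_cdf.shade_times_slope[OF mono_cdf_H])

lemma q_dual_eq: "q_dual n F G mu r w B t = (1 + t) * (\<integral>\<alpha>. gain t \<alpha> \<partial>F) + t * B"
  by (simp add: q_dual_def gain_def surplus_def)

lemma paced_graph_measurable: "(\<lambda>\<alpha>. (\<alpha>, paced t \<alpha>)) \<in> F \<rightarrow>\<^sub>M F \<Otimes>\<^sub>M borel"
  by measurable

lemma gain_measurable [measurable]: "gain t \<in> borel_measurable F"
  using measurable_compose[OF paced_graph_measurable surplus_measurable] by (simp add: gain_def[abs_def])

lemma bid_measurable [measurable]: "bid t \<in> borel_measurable F"
  using measurable_compose[OF paced_graph_measurable shade_measurable] by (simp add: bid_def[abs_def])

lemma alloc_measurable [measurable]: "alloc t \<in> borel_measurable F"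
  using measurable_compose[OF paced_graph_measurable slope_measurable] by (simp add: alloc_def[abs_def])

lemma pay_measurable [measurable]: "pay t \<in> borel_measurable F"
  unfolding pay_def[abs_def] by measurable

lemma gain_nonneg: "0 \<le> gain t \<alpha>"
  unfolding gain_def by (rule mono_cdf.surplus_nonneg[OF mono_cdf_H])

lemma alloc_bounds: "0 \<le> alloc t \<alpha>" "alloc t \<alpha> \<le> 1"
  unfolding alloc_def using mono_cdf.slope_bounds[OF mono_cdf_H] by auto

lemma bid_nonneg:
  assumes "0 < r \<alpha>" "0 \<le> w \<bullet> \<alpha>" "0 \<le> t"
  shows "0 \<le> bid t \<alpha>"
proof (cases "paced t \<alpha> < r \<alpha>")
  case True
  then show ?thesis using assms by (simp add: bid_def shade_def)
next
  case False
  then show ?thesis using mono_cdf.shade_bounds(1)[OF mono_cdf_H[of \<alpha>], of "r \<alpha>" "paced t \<alpha>"] assms(1)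
    by (simp add: bid_def)
qed

lemma paced_bounds:
  assumes "0 \<le> w \<bullet> \<alpha>" "w \<bullet> \<alpha> \<le> \<omega>" "0 \<le> t"
  shows "0 \<le> paced t \<alpha>" "paced t \<alpha> \<le> \<omega>"
proof -
  show "0 \<le> paced t \<alpha>" using assms by simp
  have "paced t \<alpha> \<le> w \<bullet> \<alpha>" using assms by (simp add: divide_le_eq algebra_simps)
  then show "paced t \<alpha> \<le> \<omega>" using assms by linarith
qed

lemma AE_bounds:
  assumes "0 \<le> t"
  shows "AE \<alpha> in F. 0 \<le> bid t \<alpha> \<and> 0 \<le> pay t \<alpha> \<and> pay t \<alpha> \<le> \<omega> \<and> gain t \<alpha> \<le> \<omega>"
  using r_pos value_bounds
proof eventually_elim
  case (elim \<alpha>)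
  have b: "0 \<le> bid t \<alpha>" using elim assms by (intro bid_nonneg) auto
  then have p: "0 \<le> pay t \<alpha>" using alloc_bounds unfolding pay_def by simp
  have "paced t \<alpha> * alloc t \<alpha> \<le> paced t \<alpha>"
    using paced_bounds[of \<alpha> t] elim assms alloc_bounds by (intro mult_left_le) auto
  also have "\<dots> \<le> \<omega>" using paced_bounds[of \<alpha> t] elim assms by auto
  finally show ?case using b p gain_nonneg[of t \<alpha>] pay_eq[of t \<alpha>] by auto
qed

lemma integrable_gain: "0 \<le> t \<Longrightarrow> integrable F (gain t)"
  using AE_bounds[of t] gain_nonneg
  by (intro F.integrable_const_bound[where B=\<omega>]) (auto elim: eventually_mono)

lemma integrable_pay: "0 \<le> t \<Longrightarrow> integrable F (pay t)"
  using AE_bounds[of t]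
  by (intro F.integrable_const_bound[where B=\<omega>]) (auto elim: eventually_mono)

text \<open>\<open>(1 + t) * gain t\<close> is the perspective of the convex surplus, hence convex in \<open>t\<close>,
  with subgradient \<open>- pay t\<close>.\<close>

lemma gain_subgradient:
  assumes "0 \<le> s" "0 \<le> t"
  shows "(1 + t) * gain t \<alpha> - (s - t) * pay t \<alpha> \<le> (1 + s) * gain s \<alpha>"
proof -
  have "(1 + s) * (gain t \<alpha> + alloc t \<alpha> * (paced s \<alpha> - paced t \<alpha>)) \<le> (1 + s) * gain s \<alpha>"
    unfolding gain_def alloc_def using assms
    by (intro mult_left_mono mono_cdf.surplus_subgradient[OF mono_cdf_H]) auto
  \<comment> \<open>Both \<open>(1 + s) * paced s \<alpha>\<close> and
    \<open>(1 + t) * paced t \<alpha>\<close> equal \<open>w \<bullet> \<alpha>\<close>; this turns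
    the difference of paced values into a multiple of \<open>t - s\<close>.\<close>
  moreover have "(1 + s) * (alloc t \<alpha> * (paced s \<alpha> - paced t \<alpha>)) = alloc t \<alpha> * (paced t \<alpha> * (t - s))"
  proof -
    have "(1 + s) * (a * (p - q)) = a * (q * (t - s))" if "(1 + s) * p = (1 + t) * q" for a p q :: real
    proof -
      have "(1 + s) * (a * (p - q)) = a * ((1 + s) * p - (1 + s) * q)" by (simp add: algebra_simps)
      then show ?thesis unfolding that by (simp add: algebra_simps)
    qed
    moreover have "(1 + s) * paced s \<alpha> = (1 + t) * paced t \<alpha>"
      using assms by simp
    ultimately show ?thesis .
  qed
  moreover have "(1 + t) * g - (s - t) * (p * a - g) \<le> g'"
    if "(1 + s) * (g + a * d) \<le> g'" "(1 + s) * (a * d) = a * (p * (t - s))" for g g' a p d :: real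
    using that by (simp add: algebra_simps)
  ultimately show ?thesis unfolding pay_eq by blast
qed

lemma q_dual_subgradient:
  assumes "0 \<le> s" "0 \<le> t"
  shows "q_dual n F G mu r w B t + (s - t) * (B - (\<integral>\<alpha>. pay t \<alpha> \<partial>F)) \<le> q_dual n F G mu r w B s"
proof -
  note int = integrable_gain[OF assms(1)] integrable_gain[OF assms(2)] integrable_pay[OF assms(2)]
  have "(\<integral>\<alpha>. (1 + t) * gain t \<alpha> - (s - t) * pay t \<alpha> \<partial>F) \<le> (\<integral>\<alpha>. (1 + s) * gain s \<alpha> \<partial>F)"
    using int by (intro integral_mono gain_subgradient[OF assms]) auto
  then show ?thesis
    using int by (simp add: q_dual_eq algebra_simps)
qed

text \<open>Dominated convergence with bound \<open>\<omega>\<close>. Continuity is needed only at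
  the limit point, where absence of atoms and of a tie with the reserve makes \<open>slope\<close>
  continuous.\<close>

lemma pay_tendsto:
  assumes "T \<longlonglongrightarrow> t" "0 \<le> t" "\<And>k. 0 \<le> T k"
  shows "(\<lambda>k. \<integral>\<alpha>. pay (T k) \<alpha> \<partial>F) \<longlonglongrightarrow> (\<integral>\<alpha>. pay t \<alpha> \<partial>F)"
proof (rule integral_dominated_convergence[where w="\<lambda>_. \<omega>"])
  show "AE \<alpha> in F. (\<lambda>k. pay (T k) \<alpha>) \<longlonglongrightarrow> pay t \<alpha>"
    using atomless no_tie[OF assms(2)]
  proof eventually_elim
    case (elim \<alpha>)
    have paced: "(\<lambda>k. paced (T k) \<alpha>) \<longlonglongrightarrow> paced t \<alpha>"
      by (intro tendsto_intros assms(1)) (use assms(2) in simp)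
    have slope: "isCont (slope (H \<alpha>) (r \<alpha>)) (paced t \<alpha>)"
      by (rule mono_cdf.isCont_slope[OF mono_cdf_H isCont_H]) (use elim in simp_all)
    have surplus: "isCont (surplus (H \<alpha>) (r \<alpha>)) (paced t \<alpha>)"
      by (rule mono_cdf.isCont_surplus[OF mono_cdf_H])
    show ?case
      unfolding pay_eq gain_def alloc_def
      by (rule tendsto_diff[OF tendsto_mult[OF paced isCont_tendsto_compose[OF slope paced]]
            isCont_tendsto_compose[OF surplus paced]])
  qed
  show "AE \<alpha> in F. norm (pay (T k) \<alpha>) \<le> \<omega>" for k
    using AE_bounds[OF assms(3)[of k]] by eventually_elim auto
qed auto

section \<open>Feasibility, slackness and optimality at a dual minimizer\<close>

context
  fixes t :: real
  assumes t_nonneg: "0 \<le> t"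
    and t_min: "\<And>s. 0 \<le> s \<Longrightarrow> q_dual n F G mu r w B t \<le> q_dual n F G mu r w B s"
begin

text \<open>At a multiplier above \<open>t\<close>, minimality of \<open>t\<close> and the
  subgradient inequality force the payment to be within budget; the multipliers then decrease to
  \<open>t\<close>.\<close>

lemma pay_le_budget: "(\<integral>\<alpha>. pay t \<alpha> \<partial>F) \<le> B"
proof -
  let ?T = "\<lambda>k. t + inverse (real (Suc k))"
  have pos: "0 < inverse (real (Suc k))" for k by simp
  have "?T \<longlonglongrightarrow> t + 0"
    by (intro tendsto_intros LIMSEQ_inverse_real_of_nat)
  moreover have nn: "0 \<le> ?T k" for k using t_nonneg pos[of k] by linarith
  ultimately have "(\<lambda>k. \<integral>\<alpha>. pay (?T k) \<alpha> \<partial>F) \<longlonglongrightarrow> (\<integral>\<alpha>. pay t \<alpha> \<partial>F)"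
    using t_nonneg by (intro pay_tendsto) auto
  moreover have "(\<integral>\<alpha>. pay (?T k) \<alpha> \<partial>F) \<le> B" for k
  proof -
    have "(t - ?T k) * (B - (\<integral>\<alpha>. pay (?T k) \<alpha> \<partial>F)) \<le> 0"
      using q_dual_subgradient[OF t_nonneg nn[of k]] t_min[OF nn[of k]] by linarith
    then have "0 \<le> inverse (real (Suc k)) * (B - (\<integral>\<alpha>. pay (?T k) \<alpha> \<partial>F))" by simp
    then show ?thesis using pos[of k] by (simp add: zero_le_mult_iff)
  qed
  ultimately show ?thesis
    by (intro LIMSEQ_le_const2[where X="\<lambda>k. \<integral>\<alpha>. pay (?T k) \<alpha> \<partial>F"]) auto
qed

lemma complementary_slackness: "t * (\<integral>\<alpha>. pay t \<alpha> \<partial>F) = t * B"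
proof (cases "t = 0")
  case False
  with t_nonneg have "0 < t" by simp
  \<comment> \<open>Approach from below gives the reverse inequality. The step is scaled by
    \<open>t\<close> so that every multiplier stays nonnegative, starting at 0 for
    \<open>k = 0\<close>.\<close>
  let ?T = "\<lambda>k. t - t * inverse (real (Suc k))"
  have pos: "0 < t * inverse (real (Suc k))" for k using \<open>0 < t\<close> by simp
  have "?T \<longlonglongrightarrow> t - t * 0"
    by (intro tendsto_intros LIMSEQ_inverse_real_of_nat)
  moreover have nn: "0 \<le> ?T k" for k
    using t_nonneg mult_left_le[of "inverse (real (Suc k))" t] by (simp add: inverse_le_1_iff)
  ultimately have "(\<lambda>k. \<integral>\<alpha>. pay (?T k) \<alpha> \<partial>F) \<longlonglongrightarrow> (\<integral>\<alpha>. pay t \<alpha> \<partial>F)"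
    using t_nonneg by (intro pay_tendsto) auto
  moreover have "B \<le> (\<integral>\<alpha>. pay (?T k) \<alpha> \<partial>F)" for k
  proof -
    have "(t - ?T k) * (B - (\<integral>\<alpha>. pay (?T k) \<alpha> \<partial>F)) \<le> 0"
      using q_dual_subgradient[OF t_nonneg nn[of k]] t_min[OF nn[of k]] by linarith
    then have "(t * inverse (real (Suc k))) * (B - (\<integral>\<alpha>. pay (?T k) \<alpha> \<partial>F)) \<le> 0" by simp
    then show ?thesis using pos[of k] by (metis diff_le_0_iff_le mult_le_0_iff not_less)
  qed
  ultimately have "B \<le> (\<integral>\<alpha>. pay t \<alpha> \<partial>F)"
    by (intro LIMSEQ_le_const[where X="\<lambda>k. \<integral>\<alpha>. pay (?T k) \<alpha> \<partial>F"]) auto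
  with pay_le_budget show ?thesis by simp
qed simp

text \<open>Above the reserve the shaded bid wins with probability \<open>H\<close>. Below it the
  bid is the paced value itself and fails the reserve. Equality is the excluded tie.\<close>

lemma win_prob_bid: "AE \<alpha> in F. win_prob (bid t) \<alpha> = alloc t \<alpha>"
  using atomless no_tie[OF t_nonneg]
proof eventually_elim
  case (elim \<alpha>)
  show ?case
  proof (cases "r \<alpha> < paced t \<alpha>")
    case True
    then show ?thesis
      using bid_win_shade[of \<alpha> "paced t \<alpha>"] elim
        mono_cdf.shade_bounds(1)[OF mono_cdf_H[of \<alpha>], of "r \<alpha>" "paced t \<alpha>"]
      by (simp add: win_prob_def bid_def alloc_def slope_def)
  next
    case False
    then show ?thesis using elim by (simp add: win_prob_def bid_def alloc_def slope_def shade_def)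
  qed
qed

lemma AE_bid_nonneg: "AE \<alpha> in F. 0 \<le> bid t \<alpha>"
  using AE_bounds[OF t_nonneg] by eventually_elim simp

lemma bid_within_budget: "Q_payment n F G mu r (bid t) \<le> ennreal B"
proof -
  have "Q_payment n F G mu r (bid t) = (\<integral>\<^sup>+\<alpha>. ennreal (pay t \<alpha>) \<partial>F)"
    unfolding payment_eq[OF bid_measurable AE_bid_nonneg]
    using win_prob_bid by (intro nn_integral_cong_AE) (auto simp: pay_def elim: eventually_mono)
  also have "\<dots> = ennreal (\<integral>\<alpha>. pay t \<alpha> \<partial>F)"
    using AE_bounds[OF t_nonneg]
    by (intro nn_integral_eq_integral integrable_pay t_nonneg) (auto elim: eventually_mono)
  finally show ?thesis using pay_le_budget by (simp add: ennreal_leI)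
qed

lemma integrable_value_win:
  assumes [measurable]: "b \<in> borel_measurable F"
  shows "integrable (F \<Otimes>\<^sub>M P) (\<lambda>z. (w \<bullet> fst z) * win b z)"
proof -
  interpret FP': prob_space "F \<Otimes>\<^sub>M P"
    by (rule prob_space_pair) unfold_locales
  note [measurable] = win_measurable[OF assms]
  have "AE z in F \<Otimes>\<^sub>M P. 0 \<le> w \<bullet> fst z \<and> w \<bullet> fst z \<le> \<omega>"
    using value_bounds by (intro FP.AE_pair_measure) auto
  then have "AE z in F \<Otimes>\<^sub>M P. norm ((w \<bullet> fst z) * win b z) \<le> \<omega>"
    by eventually_elim auto
  then show ?thesis by (intro FP'.integrable_const_bound) auto
qed

lemma integrable_bid_win:
  assumes [measurable]: "b \<in> borel_measurable F" and nn: "AE \<alpha> in F. 0 \<le> b \<alpha>"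
    and budget: "Q_payment n F G mu r b \<le> ennreal B"
  shows "integrable (F \<Otimes>\<^sub>M P) (\<lambda>z. b (fst z) * win b z)"
    and "(\<integral>z. b (fst z) * win b z \<partial>(F \<Otimes>\<^sub>M P)) \<le> B"
proof -
  note [measurable] = win_measurable[OF assms(1)]
  have m: "(\<lambda>z. b (fst z) * win b z) \<in> borel_measurable (F \<Otimes>\<^sub>M P)"
    by (intro borel_measurable_times measurable_compose[OF measurable_fst assms(1)] win_measurable assms)
  have "AE z in F \<Otimes>\<^sub>M P. 0 \<le> b (fst z)"
    using nn by (intro FP.AE_pair_measure) auto
  then have ae: "AE z in F \<Otimes>\<^sub>M P. 0 \<le> b (fst z) * win b z"
    by eventually_elim simp
  have le: "(\<integral>\<^sup>+z. ennreal (b (fst z) * win b z) \<partial>(F \<Otimes>\<^sub>M P)) \<le> ennreal B"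
    using budget by (simp add: Q_payment_def auction_space_def)
  then show int: "integrable (F \<Otimes>\<^sub>M P) (\<lambda>z. b (fst z) * win b z)"
    by (intro integrableI_nonneg m ae) (auto intro: le_less_trans)
  have "ennreal (\<integral>z. b (fst z) * win b z \<partial>(F \<Otimes>\<^sub>M P)) \<le> ennreal B"
    using le by (simp add: nn_integral_eq_integral[OF int ae])
  then show "(\<integral>z. b (fst z) * win b z \<partial>(F \<Otimes>\<^sub>M P)) \<le> B"
    using B_nonneg by (simp add: ennreal_le_iff)
qed

lemma objective_eq:
  "Q_objective n F G mu r w b = (\<integral>z. (w \<bullet> fst z - b (fst z)) * win b z \<partial>(F \<Otimes>\<^sub>M P))"
  by (simp add: Q_objective_def auction_space_def)

text \<open>Absence of a duality gap. Item by item, value won minus payment is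
  \<open>(1 + t) * gain t \<alpha> + t * pay t \<alpha>\<close>, and complementary slackness turns
  the expectation of the last term into \<open>t * B\<close>.\<close>

lemma objective_bid: "Q_objective n F G mu r w (bid t) = q_dual n F G mu r w B t"
proof -
  note int = integrable_value_win[OF bid_measurable]
    integrable_bid_win(1)[OF bid_measurable AE_bid_nonneg bid_within_budget]
  have int_obj: "integrable (F \<Otimes>\<^sub>M P) (\<lambda>z. (w \<bullet> fst z - bid t (fst z)) * win (bid t) z)"
    using Bochner_Integration.integrable_diff[OF int] by (simp only: left_diff_distrib)
  from integral_mult_win(1)[OF bid_measurable int_obj]
  have "Q_objective n F G mu r w (bid t) = (\<integral>\<alpha>. (w \<bullet> \<alpha> - bid t \<alpha>) * win_prob (bid t) \<alpha> \<partial>F)"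
    by (simp only: objective_eq)
  also have "\<dots> = (\<integral>\<alpha>. (1 + t) * gain t \<alpha> + t * pay t \<alpha> \<partial>F)"
  proof (rule integral_cong_AE)
    show "AE \<alpha> in F. (w \<bullet> \<alpha> - bid t \<alpha>) * win_prob (bid t) \<alpha> = (1 + t) * gain t \<alpha> + t * pay t \<alpha>"
      using win_prob_bid
    proof eventually_elim
      case (elim \<alpha>)
      have "(v - b) * a = (1 + t) * (p * a) - b * a" if "(1 + t) * p = v" for v p a b :: real
        unfolding that[symmetric] by (simp add: algebra_simps)
      from this[of "paced t \<alpha>" "w \<bullet> \<alpha>" "bid t \<alpha>"]
      have "(w \<bullet> \<alpha> - bid t \<alpha>) * alloc t \<alpha> = (1 + t) * (paced t \<alpha> * alloc t \<alpha>) - pay t \<alpha>"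
        using t_nonneg by (simp add: pay_def)
      also have "\<dots> = (1 + t) * gain t \<alpha> + t * pay t \<alpha>"
      proof -
        have "paced t \<alpha> * alloc t \<alpha> = gain t \<alpha> + pay t \<alpha>" unfolding pay_eq by simp
        then show ?thesis by (simp only:) (simp add: algebra_simps)
      qed
      finally show ?case using elim by simp
    qed
    show "(\<lambda>\<alpha>. (w \<bullet> \<alpha> - bid t \<alpha>) * win_prob (bid t) \<alpha>) \<in> borel_measurable F"
      using integral_mult_win(2)[OF bid_measurable int_obj] by (rule borel_measurable_integrable)
  qed measurable
  also have "\<dots> = (1 + t) * (\<integral>\<alpha>. gain t \<alpha> \<partial>F) + t * (\<integral>\<alpha>. pay t \<alpha> \<partial>F)"
    using integrable_gain[OF t_nonneg] integrable_pay[OF t_nonneg] by simp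
  finally show ?thesis unfolding complementary_slackness q_dual_eq .
qed

lemma weak_duality:
  assumes b: "b \<in> borel_measurable F" and nn: "AE \<alpha> in F. 0 \<le> b \<alpha>"
    and budget: "Q_payment n F G mu r b \<le> ennreal B"
  shows "Q_objective n F G mu r w b \<le> q_dual n F G mu r w B t"
proof -
  note int = integrable_value_win[OF b] integrable_bid_win(1)[OF b nn budget]
  let ?c = "\<lambda>\<alpha>. (1 + t) * (paced t \<alpha> - b \<alpha>)"
  have c: "?c (fst z) * win b z = (w \<bullet> fst z) * win b z - (1 + t) * (b (fst z) * win b z)" for z
  proof -
    have "(1 + t) * (p - b) * a = v * a - (1 + t) * (b * a)" if "(1 + t) * p = v" for v p a b :: real
      unfolding that[symmetric] by (simp add: algebra_simps)
    moreover have "(1 + t) * paced t (fst z) = w \<bullet> fst z" using t_nonneg by simp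
    ultimately show ?thesis .
  qed
  have intc: "integrable (F \<Otimes>\<^sub>M P) (\<lambda>z. ?c (fst z) * win b z)"
    unfolding c by (intro Bochner_Integration.integrable_diff int integrable_mult_right)
  have "Q_objective n F G mu r w b
      = (\<integral>z. (w \<bullet> fst z) * win b z \<partial>(F \<Otimes>\<^sub>M P)) - (\<integral>z. b (fst z) * win b z \<partial>(F \<Otimes>\<^sub>M P))"
    unfolding objective_eq left_diff_distrib by (rule Bochner_Integration.integral_diff[OF int])
  \<comment> \<open>The amount \<open>t * (B - payment)\<close>, nonnegative by feasibility, is
    added. What remains is \<open>(1 + t)\<close> times the profit of a buyer with value
    \<open>paced t \<alpha>\<close>, so the best-response bound applies per item.\<close>
  also have "\<dots> \<le> (\<integral>z. (w \<bullet> fst z) * win b z \<partial>(F \<Otimes>\<^sub>M P))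
      - (1 + t) * (\<integral>z. b (fst z) * win b z \<partial>(F \<Otimes>\<^sub>M P)) + t * B"
    using mult_left_mono[OF integrable_bid_win(2)[OF b nn budget] t_nonneg] by (simp add: algebra_simps)
  also have "\<dots> = (\<integral>z. ?c (fst z) * win b z \<partial>(F \<Otimes>\<^sub>M P)) + t * B"
    unfolding c using int by (simp add: Bochner_Integration.integral_diff)
  also have "(\<integral>z. ?c (fst z) * win b z \<partial>(F \<Otimes>\<^sub>M P)) = (\<integral>\<alpha>. ?c \<alpha> * win_prob b \<alpha> \<partial>F)"
    by (rule integral_mult_win(1)[OF b intc])
  also have "\<dots> \<le> (\<integral>\<alpha>. (1 + t) * gain t \<alpha> \<partial>F)"
  proof (rule integral_mono)
    show "integrable F (\<lambda>\<alpha>. ?c \<alpha> * win_prob b \<alpha>)"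
      by (rule integral_mult_win(2)[OF b intc])
    show "integrable F (\<lambda>\<alpha>. (1 + t) * gain t \<alpha>)"
      using integrable_gain[OF t_nonneg] by simp
    show "?c \<alpha> * win_prob b \<alpha> \<le> (1 + t) * gain t \<alpha>" for \<alpha>
    proof -
      have "(paced t \<alpha> - b \<alpha>) * win_prob b \<alpha> \<le> gain t \<alpha>"
        using bid_win_le[of \<alpha> "b \<alpha>" "paced t \<alpha>"] gain_nonneg[of t \<alpha>]
        by (simp add: win_prob_def gain_def)
      then show ?thesis using t_nonneg by (simp add: mult.assoc mult_left_mono)
    qed
  qed
  also have "\<dots> = (1 + t) * (\<integral>\<alpha>. gain t \<alpha> \<partial>F)" by simp
  finally show ?thesis by (simp only: q_dual_eq)
qed

end

end

section \<open>Optimality of value pacing\<close>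

theorem theorem2:
  fixes n :: nat and U Bmin \<omega> :: real
    and A :: "(real^'d) set" and F :: "(real^'d) measure" and f :: "real^'d \<Rightarrow> ennreal"
    and G :: "((real^'d) \<times> real) measure" and g :: "(real^'d) \<times> real \<Rightarrow> ennreal"
    and r :: "real^'d \<Rightarrow> real"
  assumes "n \<ge> 2" and "CARD('d) \<ge> 2" and "U > 0" and "Bmin > 0"
    and "A \<in> sets lebesgue" and "\<forall>\<alpha>\<in>A. \<forall>i. 0 < \<alpha> $ i"
    and "f \<in> borel_measurable lebesgue" and "F = density lebesgue f"
    and "prob_space F" and "emeasure F (UNIV - A) = 0"
    and "g \<in> borel_measurable lebesgue" and "G = density lebesgue g"
    and "prob_space G" and "emeasure G (UNIV - Theta U Bmin) = 0"
    and "\<omega> > 0" and "\<forall>w\<in>Theta_w U. \<forall>\<alpha>\<in>A. w \<bullet> \<alpha> \<le> \<omega>"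
    and "r \<in> borel_measurable lebesgue" and "\<forall>\<alpha>\<in>A. 0 < r \<alpha>"
  shows "\<exists>\<Theta>'. \<Theta>' \<in> sets G \<and> \<Theta>' \<subseteq> Theta U Bmin \<and> emeasure G \<Theta>' = 1 \<and>
    (\<forall>mu. pacing_function U Bmin mu \<longrightarrow>
      (\<forall>w B. (w, B) \<in> \<Theta>' \<longrightarrow>
        (\<forall>t\<^sub>s. (t\<^sub>s \<ge> 0 \<and> (\<forall>t\<ge>0. q_dual n F G mu r w B t\<^sub>s \<le> q_dual n F G mu r w B t)) \<longrightarrow>
           Q_optimal n A F G mu r w B (\<lambda>\<alpha>. sigma_fun n G mu r \<alpha> ((w \<bullet> \<alpha>) / (1 + t\<^sub>s))))))"
proof -
  interpret F: prob_space F by fact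
  interpret G: prob_space G by fact
  have sets_F: "sets F = sets lebesgue" and sets_G: "sets G = sets lebesgue"
    by (simp_all add: \<open>F = _\<close> \<open>G = _\<close>)
  have space: "space F = UNIV" "space G = UNIV"
    by (simp_all add: \<open>F = _\<close> \<open>G = _\<close>)
  have dim: "DIM(real^'d) \<ge> 2" using \<open>CARD('d) \<ge> 2\<close> by simp
  have r_F: "r \<in> borel_measurable F"
    using \<open>r \<in> _\<close> by (simp only: measurable_cong_sets[OF sets_F refl])
  have id_F: "(\<lambda>\<alpha>. \<alpha>) \<in> F \<rightarrow>\<^sub>M borel"
    by (rule measurable_lebesgue_borelI[OF sets_F]) simp
  have fst_G: "fst \<in> G \<rightarrow>\<^sub>M borel"
    by (rule measurable_lebesgue_borelI[OF sets_G]) (simp add: borel_prod[symmetric])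
  have AE_A: "AE \<alpha> in F. \<alpha> \<in> A"
    using \<open>A \<in> _\<close> \<open>emeasure F (UNIV - A) = 0\<close>
    by (intro AE_I[where N="UNIV - A"]) (auto simp: sets_F)
  have "(Theta_w U :: (real^'d) set) = box 0 (\<chi> i. U)"
    by (auto simp: Theta_w_def mem_box_cart)
  then have "open (Theta U Bmin :: ((real^'d) \<times> real) set)"
    by (simp add: Theta_def open_Times open_box)
  then have Theta: "Theta U Bmin \<in> sets G" by (simp add: sets_G borel_open)
  have AE_Theta: "AE \<theta> in G. \<theta> \<in> Theta U Bmin"
    using Theta \<open>emeasure G (UNIV - Theta U Bmin) = 0\<close> sets.compl_sets[OF Theta]
    by (intro AE_I[where N="UNIV - Theta U Bmin"]) (auto simp: space)

  \<comment> \<open>Directions in which a tie with the reserve has positive probability. Only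
    \<open>F\<close> and \<open>r\<close> enter, so the set of good buyers is fixed before
    \<open>mu\<close>.\<close>
  define W where "W = {u. measure F {\<alpha>. \<alpha> \<bullet> u = r \<alpha>} \<noteq> 0}"
  \<comment> \<open>A multiplier rescales \<open>w\<close>, so whole lines are removed: if
    \<open>w / (1 + s)\<close> lies in \<open>W\<close> for some \<open>s\<close>, then
    \<open>w\<close> lies in \<open>R\<close>.\<close>
  define R where "R = (\<Union>u\<in>W. span {u})"
  have "countable W"
    unfolding W_def
  proof (rule countable_positive_hyperplanes[OF \<open>f \<in> _\<close> \<open>F = _\<close> \<open>prob_space F\<close> r_F id_F])
    show "negligible {x. x \<bullet> v = 0}" if "v \<noteq> 0" for v :: "real^'d"
      using negligible_hyperplane[of v 0] that by (simp add: inner_commute)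
  qed
  have "R \<in> sets borel"
    unfolding R_def using \<open>countable W\<close>
    by (intro sets.countable_UN') (auto intro!: borel_closed closed_subspace)
  let ?\<Theta> = "Theta U Bmin - (R \<times> UNIV)"
  have AE_R: "AE \<theta> in G. \<theta> \<notin> R \<times> UNIV"
    unfolding R_def \<open>G = _\<close>
    by (intro AE_density_negligible \<open>g \<in> _\<close> negligible_rays dim \<open>countable W\<close>)
  have "R \<times> UNIV \<in> sets (borel \<Otimes>\<^sub>M (borel :: real measure))"
    using \<open>R \<in> sets borel\<close> by (intro pair_measureI) simp_all
  then have "R \<times> (UNIV :: real set) \<in> sets G"
    unfolding borel_prod by (simp add: sets_G sets_completionI_sets)
  then have \<Theta>_sets: "?\<Theta> \<in> sets G" using Theta by (rule sets.Diff[rotated])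
  have \<Theta>_full: "emeasure G ?\<Theta> = 1"
    using AE_Theta AE_R by (intro G.emeasure_eq_1_AE \<Theta>_sets) (auto elim: eventually_elim2)
  have "Q_optimal n A F G mu r w B (\<lambda>\<alpha>. sigma_fun n G mu r \<alpha> ((w \<bullet> \<alpha>) / (1 + t)))"
    if mu: "pacing_function U Bmin mu" and wB: "(w, B) \<in> ?\<Theta>" and t: "0 \<le> t"
      and t_min: "\<And>s. 0 \<le> s \<Longrightarrow> q_dual n F G mu r w B t \<le> q_dual n F G mu r w B s"
    for mu w B t
  proof -
    have mu_G: "mu \<in> borel_measurable G"
      using mu by (simp only: pacing_function_def measurable_cong_sets[OF sets_G refl])
    interpret auction F G n mu r
      by unfold_locales (fact sets_F sets_G mu_G r_F)+
    have w: "w \<in> Theta_w U" "w \<notin> R" and B: "0 \<le> B"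
      using wB \<open>Bmin > 0\<close> by (auto simp: Theta_def)
    have w_pos: "0 \<le> w \<bullet> \<alpha>" if "\<alpha> \<in> A" for \<alpha>
      using w(1) that \<open>\<forall>\<alpha>\<in>A. \<forall>i. 0 < \<alpha> $ i\<close>
      by (auto simp: inner_vec_def Theta_w_def less_imp_le intro!: sum_nonneg mult_nonneg_nonneg)
    have no_tie: "AE \<alpha> in F. (w \<bullet> \<alpha>) / (1 + s) \<noteq> r \<alpha>" if "0 \<le> s" for s
    proof -
      let ?u = "(1 / (1 + s)) *\<^sub>R w"
      have "?u \<notin> W"
      proof
        assume "?u \<in> W"
        moreover have "w \<in> span {?u}"
          using span_scale[OF span_base[of ?u "{?u}"], of "1 + s"] \<open>0 \<le> s\<close> by simp
        ultimately show False using w(2) by (auto simp: R_def)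
      qed
      then have "measure F {\<alpha> \<in> space F. \<alpha> \<bullet> ?u = r \<alpha>} = 0" by (simp add: W_def space)
      moreover have "{\<alpha> \<in> space F. \<alpha> \<bullet> ?u = r \<alpha>} \<in> sets F"
        using id_F r_F by measurable
      ultimately have "AE \<alpha> in F. \<not> \<alpha> \<bullet> ?u = r \<alpha>"
        by (simp add: F.prob_eq_0 space)
      then show ?thesis by eventually_elim (simp add: inner_commute)
    qed
    \<comment> \<open>This set does depend on \<open>mu\<close>, but it is used to discard item
      types only, not buyer types.\<close>
    define V where "V = {v. measure G {\<theta>. fst \<theta> \<bullet> v = 1 + mu \<theta>} \<noteq> 0}"
    have "countable V"
      unfolding V_def
    proof (rule countable_positive_hyperplanes[OF \<open>g \<in> _\<close> \<open>G = _\<close> \<open>prob_space G\<close> _ fst_G])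
      show "(\<lambda>\<theta>. 1 + mu \<theta>) \<in> borel_measurable G" using mu_G by measurable
    qed (rule negligible_fst_hyperplane)
    have "AE \<alpha> in F. \<alpha> \<notin> (\<Union>v\<in>V. span {v})"
      unfolding \<open>F = _\<close>
      by (intro AE_density_negligible \<open>f \<in> _\<close> negligible_rays dim \<open>countable V\<close>)
    then have atomless: "AE \<alpha> in F. \<forall>x. measure (L \<alpha>) {x} = 0"
      using AE_A
    proof eventually_elim
      case (elim \<alpha>)
      show ?case
      proof
        fix x
        let ?S = "{\<theta>. (fst \<theta> \<bullet> \<alpha>) / (1 + mu \<theta>) = x}"
        have S: "?S \<in> sets G"
        proof -
          have "{\<theta> \<in> space G. (fst \<theta> \<bullet> \<alpha>) / (1 + mu \<theta>) = x} \<in> sets G" by measurable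
          then show ?thesis by (simp add: space)
        qed
        have "AE \<theta> in G. \<theta> \<notin> ?S"
        \<comment> \<open>An atom at 0 is impossible because paced values of buyers in
          \<open>Theta\<close> are positive. For \<open>x \<noteq> 0\<close> the equation for an
          atom at \<open>x\<close> becomes \<open>fst \<theta> \<bullet> v = 1 + mu \<theta>\<close>
          with \<open>v = (1 / x) *\<^sub>R \<alpha>\<close>.\<close>
        proof (cases "x = 0")
          case True
          have pos: "0 < fst \<theta> \<bullet> \<alpha> \<and> 0 < 1 + mu \<theta>" if "\<theta> \<in> Theta U Bmin" for \<theta>
          proof
            show "0 < 1 + mu \<theta>" using mu that by (force simp: pacing_function_def)
            show "0 < fst \<theta> \<bullet> \<alpha>"
              using that elim \<open>\<forall>\<alpha>\<in>A. \<forall>i. 0 < \<alpha> $ i\<close>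
              by (auto simp: inner_vec_def Theta_def Theta_w_def intro!: sum_pos)
          qed
          from AE_Theta show ?thesis
          proof eventually_elim
            case (elim \<theta>)
            from pos[OF this] True show ?case by simp
          qed
        next
          case False
          have "(1 / x) *\<^sub>R \<alpha> \<notin> V"
          proof
            assume "(1 / x) *\<^sub>R \<alpha> \<in> V"
            moreover have "\<alpha> \<in> span {(1 / x) *\<^sub>R \<alpha>}"
              using span_scale[OF span_base[of "(1 / x) *\<^sub>R \<alpha>" "{(1 / x) *\<^sub>R \<alpha>}"], of x] False by simp
            ultimately show False using elim by auto
          qed
          then have "measure G {\<theta> \<in> space G. fst \<theta> \<bullet> (1 / x) *\<^sub>R \<alpha> = 1 + mu \<theta>} = 0"
            by (simp add: V_def space)
          moreover have "{\<theta> \<in> space G. fst \<theta> \<bullet> (1 / x) *\<^sub>R \<alpha> = 1 + mu \<theta>} \<in> sets G"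
            by measurable
          ultimately have "AE \<theta> in G. \<not> fst \<theta> \<bullet> (1 / x) *\<^sub>R \<alpha> = 1 + mu \<theta>"
            by (simp add: G.prob_eq_0 space)
          with AE_Theta show ?thesis
          proof eventually_elim
            case (elim \<theta>)
            then have "0 \<le> mu \<theta>" using mu by (simp add: pacing_function_def)
            with elim False show ?case by (auto simp: field_simps)
          qed
        qed
        then have "measure G ?S = 0" using S by (simp add: G.prob_eq_0)
        then show "measure (L \<alpha>) {x} = 0" by (simp add: measure_L)
      qed
    qed
    interpret auction_buyer F G n mu r w B \<omega>
    proof
      show "AE \<alpha> in F. 0 < r \<alpha>"
        using AE_A \<open>\<forall>\<alpha>\<in>A. 0 < r \<alpha>\<close> by (auto elim!: eventually_mono)
      show "AE \<alpha> in F. 0 \<le> w \<bullet> \<alpha> \<and> w \<bullet> \<alpha> \<le> \<omega>"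
        using AE_A w_pos w(1) \<open>\<forall>w\<in>Theta_w U. \<forall>\<alpha>\<in>A. w \<bullet> \<alpha> \<le> \<omega>\<close> by (auto elim!: eventually_mono)
    qed (fact atomless no_tie B)+
    have bid: "(\<lambda>\<alpha>. sigma_fun n G mu r \<alpha> ((w \<bullet> \<alpha>) / (1 + t))) = bid t"
      by (simp add: fun_eq_iff bid_def sigma_fun_eq_shade)
    \<comment> \<open>Feasibility asks for nonnegative bids at every item of \<open>A\<close>, not
      just almost everywhere, hence the pointwise \<open>bid_nonneg\<close>.\<close>
    have "Q_feasible n A F G mu r B (bid t)"
      unfolding Q_feasible_def
      using bid_nonneg t w_pos \<open>\<forall>\<alpha>\<in>A. 0 < r \<alpha>\<close> bid_within_budget[OF t t_min] by auto
    moreover have "Q_objective n F G mu r w b \<le> Q_objective n F G mu r w (bid t)"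
      if "Q_feasible n A F G mu r B b" for b
    proof -
      have "AE \<alpha> in F. 0 \<le> b \<alpha>"
        using AE_A that by (auto simp: Q_feasible_def elim!: eventually_mono)
      with that show ?thesis
        using weak_duality[OF t t_min, of b] objective_bid[OF t t_min]
        by (simp add: Q_feasible_def)
    qed
    ultimately show ?thesis unfolding Q_optimal_def bid by blast
  qed
  with \<Theta>_sets \<Theta>_full show ?thesis by (intro exI[of _ ?\<Theta>]) blast
qed

end
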